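(* Let $q$ be a power of an odd prime with $q\equiv3\pmod4$, $d=4k+3$ with $k$ a positive integer, $P=\{(x_1,\dots,x_d)\in\mathbb F_q^d: x_d=x_1^2+\cdots+x_{d-1}^2\}$, and $A\subset P$. Then \[E(A)\ll \frac{|A|^3}{q}+q^{\frac{d-2}{2}}|A|^2.\]
   Context: $E(A)=|\{(a,b,c,e)\in A^4: a+b=c+e\}|$ is the additive energy. $X\ll Y$ means $X\le CY$ with $C$ an absolute constant independent of $q$ and $A$. *)

theory Defs
  imports Complex_Main "HOL-Algebra.Ring" "HOL-Computational_Algebra.Primes"
begin

definition vecs :: "('a, 'b) ring_scheme \<Rightarrow> nat \<Rightarrow> 'a list set" where
  "vecs R d = {x. length x = d \<and> set x \<subseteq> carrier R}"

definition vadd :: "('a, 'b) ring_scheme \<Rightarrow> 'a list \<Rightarrow> 'a list \<Rightarrow> 'a list" where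
  "vadd R x y = map2 (\<lambda>u v. u \<oplus>\<^bsub>R\<^esub> v) x y"

definition paraboloid :: "('a, 'b) ring_scheme \<Rightarrow> nat \<Rightarrow> 'a list set" where
  "paraboloid R d = {x \<in> vecs R d.
      x ! (d - 1) = finsum R (\<lambda>i. x ! i \<otimes>\<^bsub>R\<^esub> x ! i) {..<d - 1}}"

definition add_energy :: "('a, 'b) ring_scheme \<Rightarrow> 'a list set \<Rightarrow> nat" where
  "add_energy R A = card {(a, b, c, e). a \<in> A \<and> b \<in> A \<and> c \<in> A \<and> e \<in> A \<and>
      vadd R a b = vadd R c e}"

end

theory Submission
  imports Defs "HOL-Algebra.Multiplicative_Group" "HOL-Analysis.Convex"
begin

text \<open>
  Put \<open>n = d - 1 = 2m\<close> with \<open>m\<close> odd, and drop the last coordinate, so that \<open>A\<close> becomes a subset of the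
  \<open>n\<close>-dimensional space with the form \<open>Q(x) = x \<bullet> x\<close>. A quadruple \<open>a + b = c + e\<close> on the paraboloid
  has a right angle at \<open>c\<close>, that is \<open>(a - c) \<bullet> (b - c) = 0\<close>, and \<open>e\<close> is determined by \<open>a, b, c\<close>.

  If \<open>a - c\<close> is isotropic, bound the choices of \<open>b\<close> trivially. There are at most
  \<open>|A|\<^sup>2 / q + q\<^bsup>m - 1\<^esup> |A|\<close> such pairs \<open>(a, c)\<close>: for each isotropic \<open>v\<close>, by Cauchy-Schwarz at least
  \<open>|A|\<^sup>2 / q\<close> pairs satisfy \<open>v \<bullet> (a - c) = 0\<close>; sum this over \<open>v\<close> and use that the number of isotropic
  vectors orthogonal to \<open>z\<close> is smaller for isotropic \<open>z \<noteq> 0\<close> than for non-isotropic \<open>z\<close>. This sign is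
  where \<open>q \<equiv> 3 (mod 4)\<close> and the oddness of \<open>m\<close> enter: they make \<open>Q\<close> elliptic.

  If \<open>a - c\<close> is not isotropic, \<open>b\<close> lies on the hyperplane through \<open>c\<close> with normal \<open>a - c\<close>. A variance
  bound for point-hyperplane incidences gives the main term \<open>|A|\<^sup>3 / q\<close> and an error controlled by the
  number of coincidences between these hyperplanes, which is at most \<open>|A|\<^sup>3\<close> because \<open>a, c, a'\<close>
  and the common hyperplane determine \<open>c'\<close>.
\<close>

section \<open>Vectors over a commutative ring\<close>

lemma vecs_0: "x \<in> vecs R 0 \<longleftrightarrow> x = []"
  by (auto simp: vecs_def)

lemma vecs_Suc: "x \<in> vecs R (Suc n) \<longleftrightarrow> (\<exists>a y. x = a # y \<and> a \<in> carrier R \<and> y \<in> vecs R n)"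
  by (cases x) (auto simp: vecs_def)

lemma vecs_Cons: "a # x \<in> vecs R (Suc n) \<longleftrightarrow> a \<in> carrier R \<and> x \<in> vecs R n"
  by (auto simp: vecs_def)

context
  fixes R :: "('a, 'b) ring_scheme" (structure)
begin

text \<open>Recursion along the lists lets the vector identities be proved by induction on the
  dimension. The finite sum in \<open>paraboloid\<close> is matched with it in
  \<open>finsum_squares_eq_dot\<close>.\<close>

fun vdot :: "'a list \<Rightarrow> 'a list \<Rightarrow> 'a" where
  "vdot (a # x) (b # y) = a \<otimes> b \<oplus> vdot x y"
| "vdot _ _ = \<zero>"

definition vsub :: "'a list \<Rightarrow> 'a list \<Rightarrow> 'a list" where
  "vsub x y = map2 (\<lambda>u v. u \<ominus> v) x y"

definition smul :: "'a \<Rightarrow> 'a list \<Rightarrow> 'a list" where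
  "smul c x = map (\<lambda>u. c \<otimes> u) x"

definition vzero :: "nat \<Rightarrow> 'a list" where
  "vzero n = replicate n \<zero>"

end

lemmas vec_defs = vadd_def vsub_def smul_def vzero_def

context cring
begin

abbreviation V where "V n \<equiv> vecs R n"
abbreviation dot where "dot \<equiv> vdot R"
abbreviation add where "add \<equiv> vadd R"
abbreviation sub where "sub \<equiv> vsub R"
abbreviation scale where "scale \<equiv> smul R"
abbreviation nul where "nul \<equiv> vzero R"

lemma vec_Cons [simp]:
  "add (a # x) (b # y) = (a \<oplus> b) # add x y"
  "sub (a # x) (b # y) = (a \<ominus> b) # sub x y"
  "scale c (a # x) = (c \<otimes> a) # scale c x"
  "nul (Suc n) = \<zero> # nul n"
  by (simp_all add: vec_defs)

lemma vec_Nil [simp]: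
  "add [] [] = []" "sub [] [] = []" "scale c [] = []" "nul 0 = []"
  by (simp_all add: vec_defs)

lemma add_closed [simp]: "x \<in> V n \<Longrightarrow> y \<in> V n \<Longrightarrow> add x y \<in> V n"
  by (induction n arbitrary: x y) (auto simp: vecs_0 vecs_Suc)

lemma sub_closed [simp]: "x \<in> V n \<Longrightarrow> y \<in> V n \<Longrightarrow> sub x y \<in> V n"
  by (induction n arbitrary: x y) (auto simp: vecs_0 vecs_Suc)

lemma scale_closed [simp]: "c \<in> carrier R \<Longrightarrow> x \<in> V n \<Longrightarrow> scale c x \<in> V n"
  by (induction n arbitrary: x) (auto simp: vecs_0 vecs_Suc)

lemma nul_closed [simp]: "nul n \<in> V n"
  by (induction n) (auto simp: vecs_0 vecs_Suc)

lemma dot_closed [simp]: "x \<in> V n \<Longrightarrow> y \<in> V n \<Longrightarrow> dot x y \<in> carrier R"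
  by (induction n arbitrary: x y) (auto simp: vecs_0 vecs_Suc)

lemma dot_comm: "x \<in> V n \<Longrightarrow> y \<in> V n \<Longrightarrow> dot x y = dot y x"
  by (induction n arbitrary: x y) (auto simp: vecs_0 vecs_Suc m_comm)

lemma dot_add_left: "x \<in> V n \<Longrightarrow> y \<in> V n \<Longrightarrow> z \<in> V n \<Longrightarrow> dot (add x y) z = dot x z \<oplus> dot y z"
proof (induction n arbitrary: x y z)
  case (Suc n)
  then obtain a b c x' y' z' where *: "x = a # x'" "y = b # y'" "z = c # z'"
    "a \<in> carrier R" "b \<in> carrier R" "c \<in> carrier R" "x' \<in> V n" "y' \<in> V n" "z' \<in> V n"
    unfolding vecs_Suc by blast
  have "dot x' z' \<in> carrier R" "dot y' z' \<in> carrier R"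
    using * by auto
  then show ?case
    using * Suc.IH[of x' y' z'] by (simp add: l_distr a_ac)
qed (auto simp: vecs_0)

lemma dot_scale_left: "c \<in> carrier R \<Longrightarrow> x \<in> V n \<Longrightarrow> y \<in> V n \<Longrightarrow> dot (scale c x) y = c \<otimes> dot x y"
  by (induction n arbitrary: x y) (auto simp: vecs_0 vecs_Suc r_distr m_assoc)

lemma sub_add: "x \<in> V n \<Longrightarrow> y \<in> V n \<Longrightarrow> add (sub x y) y = x"
  apply (induction n arbitrary: x y)
   apply (auto simp: vecs_0 vecs_Suc)
  by algebra

lemma add_sub: "x \<in> V n \<Longrightarrow> y \<in> V n \<Longrightarrow> sub (add x y) y = x"
  apply (induction n arbitrary: x y)
   apply (auto simp: vecs_0 vecs_Suc)
  by algebra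

lemma dot_add_right: "x \<in> V n \<Longrightarrow> y \<in> V n \<Longrightarrow> z \<in> V n \<Longrightarrow> dot z (add x y) = dot z x \<oplus> dot z y"
  using dot_add_left dot_comm add_closed by metis

lemma dot_scale_right: "c \<in> carrier R \<Longrightarrow> x \<in> V n \<Longrightarrow> y \<in> V n \<Longrightarrow> dot x (scale c y) = c \<otimes> dot x y"
  using dot_scale_left dot_comm scale_closed by metis

lemma dot_sub_left:
  assumes "x \<in> V n" "y \<in> V n" "z \<in> V n"
  shows "dot (sub x y) z = dot x z \<ominus> dot y z"
proof -
  have "dot x z = dot (sub x y) z \<oplus> dot y z"
    using assms by (metis dot_add_left sub_add sub_closed)
  moreover have "dot (sub x y) z \<in> carrier R" "dot y z \<in> carrier R"
    using assms by (auto intro: dot_closed[of _ n] sub_closed)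
  ultimately show ?thesis by (simp add: a_minus_def a_assoc r_neg)
qed

lemma dot_sub_right: "x \<in> V n \<Longrightarrow> y \<in> V n \<Longrightarrow> z \<in> V n \<Longrightarrow> dot z (sub x y) = dot z x \<ominus> dot z y"
  using dot_sub_left dot_comm sub_closed by metis

lemma dot_nul: "x \<in> V n \<Longrightarrow> dot (nul n) x = \<zero>"
  by (induction n arbitrary: x) (auto simp: vecs_0 vecs_Suc)

lemma dot_nul_right: "x \<in> V n \<Longrightarrow> dot x (nul n) = \<zero>"
  by (metis dot_nul dot_comm nul_closed)

lemma sub_eq_nul: "x \<in> V n \<Longrightarrow> y \<in> V n \<Longrightarrow> sub x y = nul n \<longleftrightarrow> x = y"
  by (induction n arbitrary: x y) (auto simp: vecs_0 vecs_Suc r_right_minus_eq)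

lemma add_right_cancel:
  "x \<in> V n \<Longrightarrow> y \<in> V n \<Longrightarrow> z \<in> V n \<Longrightarrow> add x z = add y z \<longleftrightarrow> x = y"
  by (metis add_sub)

lemma add_comm: "x \<in> V n \<Longrightarrow> y \<in> V n \<Longrightarrow> add x y = add y x"
  by (induction n arbitrary: x y) (auto simp: vecs_0 vecs_Suc a_comm)

lemma add_left_cancel: "x \<in> V n \<Longrightarrow> y \<in> V n \<Longrightarrow> z \<in> V n \<Longrightarrow> add z x = add z y \<longleftrightarrow> x = y"
  using add_comm[of x n z] add_comm[of y n z] add_right_cancel[of x n y z] by simp

text \<open>This expansion is used in two special cases: for isotropic \<open>z\<close> it is affine
  in \<open>l\<close>, and for \<open>x\<close> orthogonal to \<open>z\<close> the cross term
  vanishes.\<close>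

lemma dot_add_scale_self:
  assumes "x \<in> V n" "z \<in> V n" "l \<in> carrier R"
  shows "dot (add x (scale l z)) (add x (scale l z)) =
    dot x x \<oplus> l \<otimes> (dot x z \<oplus> dot x z) \<oplus> l \<otimes> l \<otimes> dot z z"
proof -
  have c: "dot x x \<in> carrier R" "dot x z \<in> carrier R" "dot z z \<in> carrier R" using assms by auto
  have "dot (add x (scale l z)) (add x (scale l z)) =
      (dot x x \<oplus> l \<otimes> dot x z) \<oplus> l \<otimes> (dot x z \<oplus> l \<otimes> dot z z)"
    using assms dot_comm[OF assms(2,1)]
    by (simp add: dot_add_left[where n = n] dot_add_right[where n = n]
        dot_scale_left[where n = n] dot_scale_right[where n = n])
  also have "\<dots> = dot x x \<oplus> l \<otimes> (dot x z \<oplus> dot x z) \<oplus> l \<otimes> l \<otimes> dot z z"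
    using c assms(3) by (simp add: r_distr a_ac m_assoc)
  finally show ?thesis .
qed

lemma scale_uminus_add:
  "x \<in> V n \<Longrightarrow> z \<in> V n \<Longrightarrow> l \<in> carrier R \<Longrightarrow> add (add x (scale (\<ominus> l) z)) (scale l z) = x"
proof (induction n arbitrary: x z)
  case (Suc n)
  have "a \<oplus> \<ominus> l \<otimes> b \<oplus> l \<otimes> b = a" if "a \<in> carrier R" "b \<in> carrier R" for a b
    using that Suc.prems(3) by (simp add: a_assoc l_minus l_neg)
  then show ?case using Suc by (auto simp: vecs_Suc)
qed (auto simp: vecs_0)

section \<open>The paraboloid as the graph of the quadratic form\<close>

lemma dot_snoc:
  "x \<in> V n \<Longrightarrow> y \<in> V n \<Longrightarrow> a \<in> carrier R \<Longrightarrow> b \<in> carrier R \<Longrightarrow>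
    dot (x @ [a]) (y @ [b]) = dot x y \<oplus> a \<otimes> b"
  by (induction n arbitrary: x y) (auto simp: vecs_0 vecs_Suc a_assoc)

lemma vecs_snoc: "x \<in> vecs R (Suc n) \<longleftrightarrow> (\<exists>y a. x = y @ [a] \<and> y \<in> vecs R n \<and> a \<in> carrier R)"
  by (cases x rule: rev_cases) (auto simp: vecs_def)

lemma finsum_squares_eq_dot:
  assumes "x \<in> V n"
  shows "finsum R (\<lambda>i. x ! i \<otimes> x ! i) {..<n} = dot x x"
  using assms
proof (induction n arbitrary: x)
  case (Suc n)
  then obtain y a where x: "x = y @ [a]" "y \<in> V n" "a \<in> carrier R" by (auto simp: vecs_snoc)
  have len: "length y = n" using x by (simp add: vecs_def)
  have mem: "y ! i \<in> carrier R" if "i < n" for i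
    using x that by (auto simp: vecs_def)
  have "finsum R (\<lambda>i. x ! i \<otimes> x ! i) {..<Suc n} = a \<otimes> a \<oplus> finsum R (\<lambda>i. x ! i \<otimes> x ! i) {..<n}"
    unfolding lessThan_Suc using x len mem by (subst finsum_insert) (auto simp: nth_append)
  also have "finsum R (\<lambda>i. x ! i \<otimes> x ! i) {..<n} = finsum R (\<lambda>i. y ! i \<otimes> y ! i) {..<n}"
    using x len mem by (intro finsum_cong) (auto simp: nth_append simp_implies_def)
  finally show ?case using Suc.IH[OF x(2)] x by (simp add: dot_snoc a_comm)
qed (simp add: vecs_0)

text \<open>The paraboloid is a graph over its first \<open>n\<close> coordinates. Dropping the last
  coordinate therefore loses no information.\<close>

lemma mem_paraboloid: "x \<in> paraboloid R (Suc n) \<longleftrightarrow> (\<exists>y\<in>V n. x = y @ [dot y y])"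
proof -
  have *: "(y @ [a]) ! n = finsum R (\<lambda>i. (y @ [a]) ! i \<otimes> (y @ [a]) ! i) {..<n} \<longleftrightarrow> a = dot y y"
    if y: "y \<in> V n" for y a
  proof -
    have len: "length y = n" using y by (simp add: vecs_def)
    have mem: "y ! i \<in> carrier R" if "i < n" for i using y that by (auto simp: vecs_def)
    have "finsum R (\<lambda>i. (y @ [a]) ! i \<otimes> (y @ [a]) ! i) {..<n} = finsum R (\<lambda>i. y ! i \<otimes> y ! i) {..<n}"
      using len mem by (intro finsum_cong) (auto simp: nth_append simp_implies_def)
    then show ?thesis using finsum_squares_eq_dot[OF y] len by (simp add: nth_append)
  qed
  show ?thesis unfolding paraboloid_def mem_Collect_eq vecs_snoc using * by auto
qed

lemma add_snoc: "x \<in> V n \<Longrightarrow> y \<in> V n \<Longrightarrow> add (x @ [a]) (y @ [b]) = add x y @ [a \<oplus> b]"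
  by (simp add: vadd_def vecs_def)

text \<open>Put \<open>e = a + b - c\<close> into the quadratic condition: everything cancels except
  twice the product of \<open>a - c\<close> and \<open>b - c\<close>. The factor 2 stays because it
  need not be cancellable in a commutative ring; \<open>double_eq_zero\<close> removes it
  later.\<close>

lemma dot_sub_sub_add_self:
  assumes V: "a \<in> V n" "b \<in> V n" "c \<in> V n" "e \<in> V n"
    and sum: "add a b = add c e" and sq: "dot a a \<oplus> dot b b = dot c c \<oplus> dot e e"
  shows "dot (sub a c) (sub b c) \<oplus> dot (sub a c) (sub b c) = \<zero>"
proof -
  have e: "dot x e = (dot x a \<oplus> dot x b) \<ominus> dot x c" if "x \<in> V n" for x
  proof -
    have cl: "dot x a \<in> carrier R" "dot x b \<in> carrier R" "dot x c \<in> carrier R" "dot x e \<in> carrier R"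
      using that V by auto
    have "dot x a \<oplus> dot x b = dot x c \<oplus> dot x e"
      using arg_cong[OF sum, of "dot x"] that V by (simp add: dot_add_right[where n = n])
    then have "(dot x a \<oplus> dot x b) \<ominus> dot x c = (dot x c \<oplus> dot x e) \<ominus> dot x c" by simp
    also have "\<dots> = dot x e" using cl by algebra
    finally show ?thesis by simp
  qed
  define x where "x = dot (sub a c) (sub b c)"
  have cl: "dot a a \<in> carrier R" "dot b b \<in> carrier R" "dot c c \<in> carrier R"
     "dot a b \<in> carrier R" "dot a c \<in> carrier R" "dot b c \<in> carrier R" using V by auto
  have sym: "dot b a = dot a b" "dot c a = dot a c" "dot c b = dot b c"
     "dot e a = dot a e" "dot e b = dot b e" "dot e c = dot c e"
    using V dot_comm by auto
  have x: "x = (dot a b \<ominus> dot a c) \<ominus> (dot b c \<ominus> dot c c)"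
    using V cl unfolding x_def
    by (simp add: dot_sub_left[where n = n] dot_sub_right[where n = n] sym a_minus_def minus_add a_ac)
  have "(dot a a \<oplus> dot b b) \<oplus> (x \<oplus> x) = dot c c \<oplus> dot e e"
    unfolding e[OF V(4)] sym e[OF V(1)] e[OF V(2)] e[OF V(3)] x using cl
    by (simp add: a_minus_def minus_add a_ac)
  then have "(dot a a \<oplus> dot b b) \<oplus> (x \<oplus> x) = dot a a \<oplus> dot b b" using sq by simp
  moreover have "x \<in> carrier R" using x cl by simp
  ultimately show ?thesis unfolding x_def[symmetric]
    using cl add.l_cancel_one[of "dot a a \<oplus> dot b b" "x \<oplus> x"] by simp
qed

end

section \<open>Hyperplanes over a finite field\<close>

lemma sum_card_swap:
  assumes "finite A" "finite B"
  shows "(\<Sum>a\<in>A. card {b \<in> B. P a b}) = (\<Sum>b\<in>B. card {a \<in> A. P a b})"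
proof -
  have "(\<Sum>a\<in>A. card {b \<in> B. P a b}) = (\<Sum>a\<in>A. \<Sum>b\<in>B. of_bool (P a b))"
    using assms by (simp add: Int_def)
  also have "\<dots> = (\<Sum>b\<in>B. \<Sum>a\<in>A. of_bool (P a b))" by (rule sum.swap)
  finally show ?thesis using assms by (simp add: Int_def)
qed

lemma card_eq_fibre_squares:
  assumes "finite A" "finite T" "f ` A \<subseteq> T"
  shows "card {(a, c) \<in> A \<times> A. f a = f c} = (\<Sum>t\<in>T. (card {a \<in> A. f a = t})\<^sup>2)"
proof -
  have "card {(a, c) \<in> A \<times> A. f a = f c} = card (\<Union>t\<in>T. {a \<in> A. f a = t} \<times> {a \<in> A. f a = t})"
    using assms by (intro arg_cong[where f = card]) auto
  also have "\<dots> = (\<Sum>t\<in>T. card ({a \<in> A. f a = t} \<times> {a \<in> A. f a = t}))"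
    using assms by (intro card_UN_disjoint) auto
  finally show ?thesis by (simp add: card_cartesian_product power2_eq_square)
qed

locale fin_field = field R for R (structure) +
  assumes finite_carrier: "finite (carrier R)"
begin

abbreviation q where "q \<equiv> card (carrier R)"

lemma finite_V [simp]: "finite (V n)"
  and card_V: "card (V n) = q ^ n"
proof -
  have "V n = {xs. set xs \<subseteq> carrier R \<and> length xs = n}" by (auto simp: vecs_def)
  then show "finite (V n)" "card (V n) = q ^ n"
    using finite_lists_length_eq[OF finite_carrier] card_lists_length_eq[OF finite_carrier] by auto
qed

lemma q_ge_2: "2 \<le> q"
proof -
  have "card {\<zero>, \<one>} \<le> q" by (rule card_mono) (auto simp: finite_carrier)
  then show ?thesis by simp
qed

text \<open>The form is nondegenerate: at a nonzero coordinate of \<open>v\<close>, take the unit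
  vector scaled by the inverse of that coordinate.\<close>

lemma dot_eq_oneE:
  assumes "v \<in> V n" "v \<noteq> nul n"
  obtains y where "y \<in> V n" "dot y v = \<one>"
proof -
  have "\<exists>y\<in>V n. dot y v = \<one>" using assms
  proof (induction n arbitrary: v)
    case 0
    then show ?case by (simp add: vecs_0)
  next
    case (Suc n)
    then obtain a x where *: "v = a # x" "a \<in> carrier R" "x \<in> V n" by (auto simp: vecs_Suc)
    show ?case
    proof (cases "a = \<zero>")
      case True
      then obtain y where "y \<in> V n" "dot y x = \<one>" using Suc * by auto
      then show ?thesis using True * by (intro bexI[of _ "\<zero> # y"]) (auto simp: vecs_Cons)
    next
      case False
      then have "inv a \<in> carrier R" "inv a \<otimes> a = \<one>" using * field_Units by auto
      then show ?thesis using * by (intro bexI[of _ "inv a # nul n"]) (auto simp: vecs_Cons dot_nul)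
    qed
  qed
  then show ?thesis using that by blast
qed

text \<open>Translation by multiples of a \<open>y\<close> with \<open>dot y v = \<one>\<close>
  carries any fibre of \<open>dot _ v\<close> injectively into any other. Hence the \<open>q\<close>
  fibres partition the space into sets of equal size. The factor \<open>q\<close> on the left avoids
  the exponent \<open>n - 1\<close>.\<close>

lemma card_hyperplane:
  assumes v: "v \<in> V n" "v \<noteq> nul n" and t: "t \<in> carrier R"
  shows "q * card {x \<in> V n. dot x v = t} = q ^ n"
proof -
  obtain y where y: "y \<in> V n" "dot y v = \<one>" using dot_eq_oneE[OF v] .
  have eq: "card {x \<in> V n. dot x v = s} = card {x \<in> V n. dot x v = t}" if s: "s \<in> carrier R" for s
  proof (rule card_bij_eq)
    have aux: "(\<lambda>x. add x (scale (r \<ominus> u) y)) ` {x \<in> V n. dot x v = u} \<subseteq> {x \<in> V n. dot x v = r}"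
      if "r \<in> carrier R" "u \<in> carrier R" for r u
    proof -
      have "u \<oplus> (r \<ominus> u) = r" using that by algebra
      then show ?thesis using that y v by (auto simp: dot_add_left dot_scale_left)
    qed
    show "(\<lambda>x. add x (scale (t \<ominus> s) y)) ` {x \<in> V n. dot x v = s} \<subseteq> {x \<in> V n. dot x v = t}"
         "(\<lambda>x. add x (scale (s \<ominus> t) y)) ` {x \<in> V n. dot x v = t} \<subseteq> {x \<in> V n. dot x v = s}"
      using aux s t by auto
    show "inj_on (\<lambda>x. add x (scale (t \<ominus> s) y)) {x \<in> V n. dot x v = s}"
         "inj_on (\<lambda>x. add x (scale (s \<ominus> t) y)) {x \<in> V n. dot x v = t}"
      using s t y by (auto simp: inj_on_def add_right_cancel[where n = n])
  qed auto
  have "q ^ n = card (\<Union>s\<in>carrier R. {x \<in> V n. dot x v = s})"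
    unfolding card_V[symmetric] using v by (intro arg_cong[where f = card]) auto
  also have "\<dots> = (\<Sum>s\<in>carrier R. card {x \<in> V n. dot x v = s})"
    by (rule card_UN_disjoint) (auto simp: finite_carrier)
  also have "\<dots> = q * card {x \<in> V n. dot x v = t}" using eq by simp
  finally show ?thesis by simp
qed

lemma linear_solve:
  assumes "a \<in> carrier R" "b \<in> carrier R" "a \<noteq> \<zero>"
  shows "\<exists>!l. l \<in> carrier R \<and> b \<oplus> l \<otimes> a = \<zero>"
proof
  have i: "inv a \<in> carrier R" "inv a \<otimes> a = \<one>" using assms field_Units by auto
  have "b \<oplus> \<ominus> b \<otimes> inv a \<otimes> a = b \<oplus> \<ominus> b \<otimes> (inv a \<otimes> a)" using assms i(1) by (simp add: m_assoc)
  then show "\<ominus> b \<otimes> inv a \<in> carrier R \<and> b \<oplus> \<ominus> b \<otimes> inv a \<otimes> a = \<zero>"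
    using assms i by (simp add: r_neg)
  fix l assume l: "l \<in> carrier R \<and> b \<oplus> l \<otimes> a = \<zero>"
  then have "l \<otimes> a = \<ominus> b" using assms by (metis m_closed minus_equality a_comm minus_minus)
  then have "l \<otimes> a \<otimes> inv a = \<ominus> b \<otimes> inv a" by simp
  then show "l = \<ominus> b \<otimes> inv a" using l assms i by (simp add: m_assoc m_comm[of a])
qed

lemma card_linear_solve:
  assumes "a \<in> carrier R" "b \<in> carrier R" "a \<noteq> \<zero>"
  shows "card {l \<in> carrier R. b \<oplus> l \<otimes> a = \<zero>} = 1"
  using linear_solve[OF assms] by (simp add: card_1_singleton_iff set_eq_iff) metis

text \<open>Each point off the intersection lies on exactly one member of the pencil spanned by the two hyperplanes.\<close>

lemma card_hyperplane_inter:
  assumes v: "v \<in> V n" "v \<noteq> nul n" "s \<in> carrier R" and w: "w \<in> V n" "t \<in> carrier R"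
    and indep: "\<not> (\<exists>c\<in>carrier R. w = scale c v)"
  shows "q ^ 2 * card {x \<in> V n. dot x v = s \<and> dot x w = t} = q ^ n"
proof -
  let ?N = "card {x \<in> V n. dot x v = s \<and> dot x w = t}"
  define a b where "a x = dot x v \<ominus> s" and "b x = dot x w \<ominus> t" for x
  have ab: "a x \<in> carrier R" "b x \<in> carrier R" "a x = \<zero> \<longleftrightarrow> dot x v = s" "b x = \<zero> \<longleftrightarrow> dot x w = t"
    if "x \<in> V n" for x using that v w by (auto simp: a_def b_def)
  \<comment> \<open>The pencil consists of the \<open>q\<close> hyperplanes
    \<open>b + l a = 0\<close> and the hyperplane \<open>a = 0\<close>. A point of the intersection
    lies on all \<open>q + 1\<close> of them, any other point on exactly one.\<close>
  have one: "card {l \<in> carrier R. b x \<oplus> l \<otimes> a x = \<zero>} + of_bool (a x = \<zero>)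
      = 1 + q * of_bool (dot x v = s \<and> dot x w = t)" if "x \<in> V n" for x
    using ab[OF that] card_linear_solve[of "a x" "b x"]
    by (cases "a x = \<zero>"; cases "b x = \<zero>") (auto cong: conj_cong)
  have "q * card {x \<in> V n. b x \<oplus> l \<otimes> a x = \<zero>} = q ^ n" if l: "l \<in> carrier R" for l
  proof -
    have "{x \<in> V n. b x \<oplus> l \<otimes> a x = \<zero>} = {x \<in> V n. dot x (add w (scale l v)) = t \<oplus> l \<otimes> s}"
    proof -
      have "b x \<oplus> l \<otimes> a x = dot x (add w (scale l v)) \<ominus> (t \<oplus> l \<otimes> s)" if "x \<in> V n" for x
      proof -
        have "dot x v \<in> carrier R" "dot x w \<in> carrier R" using that v w by auto
        then show ?thesis using that v w l
          by (simp add: dot_add_right dot_scale_right a_def b_def a_minus_def minus_add r_distr r_minus a_ac)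
      qed
      then show ?thesis using v w l by auto
    qed
    \<comment> \<open>Independence of the normals makes every member of the pencil a genuine
      hyperplane, with \<open>q^(n - 1)\<close> points.\<close>
    moreover have "add w (scale l v) \<noteq> nul n"
    proof
      assume *: "add w (scale l v) = nul n"
      have "w = scale (\<ominus> l) v" using v(1) w(1) * l
        by (induction n arbitrary: v w)
          (auto simp: vecs_0 vecs_Suc l_minus minus_equality dest!: minus_equality[symmetric])
      then show False using indep l by blast
    qed
    ultimately show ?thesis using card_hyperplane v w l by simp
  qed
  then have "(\<Sum>l\<in>carrier R. q * card {x \<in> V n. b x \<oplus> l \<otimes> a x = \<zero>}) = q * q ^ n" by simp
  moreover have "q * card {x \<in> V n. a x = \<zero>} = q ^ n"
  proof -
    have "{x \<in> V n. a x = \<zero>} = {x \<in> V n. dot x v = s}" using ab by auto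
    then show ?thesis using card_hyperplane v by simp
  qed
  ultimately have "q * ((\<Sum>l\<in>carrier R. card {x \<in> V n. b x \<oplus> l \<otimes> a x = \<zero>}) + card {x \<in> V n. a x = \<zero>})
     = q * q ^ n + q ^ n" by (simp add: sum_distrib_left distrib_left)
  also have "(\<Sum>l\<in>carrier R. card {x \<in> V n. b x \<oplus> l \<otimes> a x = \<zero>}) =
     (\<Sum>x\<in>V n. card {l \<in> carrier R. b x \<oplus> l \<otimes> a x = \<zero>})"
  proof -
    have "(\<Sum>l\<in>carrier R. card {x \<in> V n. b x \<oplus> l \<otimes> a x = \<zero>}) =
       (\<Sum>l\<in>carrier R. \<Sum>x\<in>V n. of_bool (b x \<oplus> l \<otimes> a x = \<zero>))"
      by (simp add: Int_def)
    also have "\<dots> = (\<Sum>x\<in>V n. \<Sum>l\<in>carrier R. of_bool (b x \<oplus> l \<otimes> a x = \<zero>))"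
      by (rule sum.swap)
    finally show ?thesis by (simp add: Int_def finite_carrier)
  qed
  also have "card {x \<in> V n. a x = \<zero>} = (\<Sum>x\<in>V n. of_bool (a x = \<zero>))" by (simp add: Int_def)
  also have "(\<Sum>x\<in>V n. card {l \<in> carrier R. b x \<oplus> l \<otimes> a x = \<zero>}) + (\<Sum>x\<in>V n. of_bool (a x = \<zero>))
     = (\<Sum>x\<in>V n. 1 + q * of_bool (dot x v = s \<and> dot x w = t))"
    unfolding sum.distrib[symmetric] using one by (intro sum.cong) auto
  also have "\<dots> = q ^ n + q * ?N"
    by (subst sum.distrib) (simp add: card_V Int_def flip: sum_distrib_left)
  finally show ?thesis by (simp add: algebra_simps power2_eq_square)
qed

text \<open>Second moment method: the number \<open>g b\<close> of hyperplanes through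
  \<open>b\<close> has mean \<open>M / q\<close> over the whole space, and its variance is
  controlled because two hyperplanes with independent normals meet in exactly the expected number of
  points. \<open>D\<close> counts the pairs of indices whose equations are proportional, that is,
  which give the same hyperplane.\<close>

lemma incidence_bound:
  fixes w :: "'i \<Rightarrow> 'a list" and t :: "'i \<Rightarrow> 'a"
  assumes I: "finite I" and S: "S \<subseteq> V n"
    and w: "\<And>i. i \<in> I \<Longrightarrow> w i \<in> V n" "\<And>i. i \<in> I \<Longrightarrow> w i \<noteq> nul n"
    and t: "\<And>i. i \<in> I \<Longrightarrow> t i \<in> carrier R"
  defines "D \<equiv> card {(i, j) \<in> I \<times> I. \<exists>c\<in>carrier R. w j = scale c (w i) \<and> t j = c \<otimes> t i}"
  shows "(\<Sum>i\<in>I. real (card {b \<in> S. dot b (w i) = t i})) \<le>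
    real (card S) * real (card I) / real q + sqrt (real (card S) * (real q ^ n / real q * real D))"
proof -
  define M where "M = real (card I)"
  define e :: "'i \<Rightarrow> 'a list \<Rightarrow> real" where "e i b = of_bool (dot b (w i) = t i)" for i b
  define g where "g b = (\<Sum>i\<in>I. e i b)" for b
  define P where "P i j \<longleftrightarrow> (\<exists>c\<in>carrier R. w j = scale c (w i) \<and> t j = c \<otimes> t i)" for i j
  have q0: "real q > 0" using q_ge_2 by simp
  have fS: "finite S" using S finite_V finite_subset by blast
  have hyp: "(\<Sum>b\<in>V n. e i b) = real q ^ n / real q" if "i \<in> I" for i
  proof -
    have "real q * real (card {b \<in> V n. dot b (w i) = t i}) = real q ^ n"
      using card_hyperplane[OF w[OF that] t[OF that]] by (metis of_nat_mult of_nat_power)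
    then show ?thesis using q0 by (simp add: e_def Int_def field_simps)
  qed
  have pair: "(\<Sum>b\<in>V n. e i b * e j b) \<le> real q ^ n / real q ^ 2 + real q ^ n / real q * of_bool (P i j)"
    if ij: "i \<in> I" "j \<in> I" for i j
  proof -
    have eq: "(\<Sum>b\<in>V n. e i b * e j b) = real (card {b \<in> V n. dot b (w i) = t i \<and> dot b (w j) = t j})"
      by (simp add: e_def Int_def flip: of_bool_conj)
    \<comment> \<open>The hyperplanes coincide, have independent normals, or are parallel and
      disjoint. Only the first case needs the extra term.\<close>
    consider "P i j" | "\<not> (\<exists>c\<in>carrier R. w j = scale c (w i))"
      | c where "c \<in> carrier R" "w j = scale c (w i)" "t j \<noteq> c \<otimes> t i"
      unfolding P_def by blast
    then show ?thesis
    proof cases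
      case 1
      have "(\<Sum>b\<in>V n. e i b * e j b) \<le> (\<Sum>b\<in>V n. e i b)"
        by (intro sum_mono) (auto simp: e_def)
      then show ?thesis using 1 hyp[OF ij(1)] by (simp add: add_increasing)
    next
      case 2
      have "real (q ^ 2 * card {b \<in> V n. dot b (w i) = t i \<and> dot b (w j) = t j}) = real (q ^ n)"
        using card_hyperplane_inter[OF w[OF ij(1)] t[OF ij(1)] w(1)[OF ij(2)] t[OF ij(2)] 2] by (simp only:)
      then show ?thesis using q0 unfolding eq by (simp add: field_simps)
    next
      case 3
      then have "{b \<in> V n. dot b (w i) = t i \<and> dot b (w j) = t j} = {}"
        using w(1)[OF ij(1)] by (auto simp: dot_scale_right)
      then show ?thesis unfolding eq by (simp only: card.empty of_nat_0) simp
    qed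
  qed
  have E1: "(\<Sum>b\<in>V n. g b) = M * (real q ^ n / real q)"
  proof -
    have "(\<Sum>b\<in>V n. g b) = (\<Sum>i\<in>I. \<Sum>b\<in>V n. e i b)" unfolding g_def by (rule sum.swap)
    then show ?thesis using hyp by (simp add: M_def)
  qed
  have E2: "(\<Sum>b\<in>V n. (g b)\<^sup>2) \<le> M\<^sup>2 * (real q ^ n / real q ^ 2) + real q ^ n / real q * real D"
  proof -
    have "(\<Sum>b\<in>V n. (g b)\<^sup>2) = (\<Sum>b\<in>V n. \<Sum>i\<in>I. \<Sum>j\<in>I. e i b * e j b)"
      unfolding g_def power2_eq_square sum_product ..
    also have "\<dots> = (\<Sum>i\<in>I. \<Sum>b\<in>V n. \<Sum>j\<in>I. e i b * e j b)" by (rule sum.swap)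
    also have "\<dots> = (\<Sum>i\<in>I. \<Sum>j\<in>I. \<Sum>b\<in>V n. e i b * e j b)" by (intro sum.cong refl sum.swap)
    also have "\<dots> \<le> (\<Sum>i\<in>I. \<Sum>j\<in>I. real q ^ n / real q ^ 2 + real q ^ n / real q * of_bool (P i j))"
      by (intro sum_mono pair)
    also have "\<dots> = M\<^sup>2 * (real q ^ n / real q ^ 2) + real q ^ n / real q * (\<Sum>i\<in>I. \<Sum>j\<in>I. of_bool (P i j))"
      by (simp add: sum.distrib M_def power2_eq_square sum_distrib_left)
    also have "(\<Sum>i\<in>I. \<Sum>j\<in>I. of_bool (P i j)) = real D"
    proof -
      have "D = card {z \<in> I \<times> I. case z of (i, j) \<Rightarrow> P i j}"
        unfolding D_def by (rule arg_cong[where f = card]) (auto simp: P_def)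
      also have "real \<dots> = (\<Sum>z\<in>I \<times> I. of_bool (case z of (i, j) \<Rightarrow> P i j))"
        using I by (simp add: Int_def)
      finally show ?thesis by (simp add: case_prod_unfold sum.cartesian_product)
    qed
    finally show ?thesis .
  qed
  have var: "(\<Sum>b\<in>V n. (g b - M / real q)\<^sup>2) \<le> real q ^ n / real q * real D"
  proof -
    have "(\<Sum>b\<in>V n. (g b - M / real q)\<^sup>2) =
        (\<Sum>b\<in>V n. (g b)\<^sup>2) - 2 * (M / real q) * (\<Sum>b\<in>V n. g b) + real q ^ n * (M / real q)\<^sup>2"
      by (simp add: power2_diff sum.distrib sum_subtractf sum_distrib_left sum_divide_distrib card_V mult_ac)
    also have "\<dots> = (\<Sum>b\<in>V n. (g b)\<^sup>2) - M\<^sup>2 * (real q ^ n / real q ^ 2)"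
      using q0 unfolding E1 by (simp add: field_simps power2_eq_square)
    also have "\<dots> \<le> real q ^ n / real q * real D"
      using E2 by simp
    finally show ?thesis .
  qed
  have "(\<Sum>i\<in>I. real (card {b \<in> S. dot b (w i) = t i})) = (\<Sum>i\<in>I. \<Sum>b\<in>S. e i b)"
    using fS by (simp add: e_def Int_def)
  also have "\<dots> = (\<Sum>b\<in>S. g b)" unfolding g_def by (rule sum.swap)
  also have "\<dots> = card S * M / real q + (\<Sum>b\<in>S. g b - M / real q)"
    by (simp add: sum_subtractf)
  also have "(\<Sum>b\<in>S. g b - M / real q) \<le> sqrt (real (card S) * (real q ^ n / real q * real D))"
  proof (rule real_le_rsqrt)
    \<comment> \<open>Cauchy-Schwarz on \<open>S\<close>; since the squares are nonnegative, the sum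
      may then be extended to all of \<open>V n\<close>, where \<open>var\<close> applies.\<close>
    have "(\<Sum>b\<in>S. g b - M / real q)\<^sup>2 \<le> (\<Sum>b\<in>S. (g b - M / real q)\<^sup>2) * real (card S)"
      by (rule sum_squared_le_sum_of_squares)
    also have "\<dots> \<le> (\<Sum>b\<in>V n. (g b - M / real q)\<^sup>2) * real (card S)"
      by (intro mult_right_mono sum_mono2 S) auto
    also have "\<dots> \<le> (real q ^ n / real q * real D) * real (card S)"
      using var by (intro mult_right_mono) auto
    finally show "(\<Sum>b\<in>S. g b - M / real q)\<^sup>2 \<le> real (card S) * (real q ^ n / real q * real D)"
      by (simp add: mult.commute)
  qed
  finally show ?thesis by (simp add: M_def)
qed

text \<open>Each pair \<open>(a, c)\<close> in \<open>I\<close> indexes the hyperplane through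
  \<open>c\<close> with normal \<open>a - c\<close>, and \<open>incidence_bound\<close> is applied
  with \<open>A\<close> as the set of points. With at most \<open>|A|^3\<close> coincidences the
  square root becomes a multiple of \<open>|A|^2\<close>.\<close>

lemma nonisotropic_corners:
  assumes A: "A \<subseteq> V n"
  defines "I \<equiv> {(a, c) \<in> A \<times> A. dot (sub a c) (sub a c) \<noteq> \<zero>}"
  shows "(\<Sum>(a, c)\<in>I. real (card {b \<in> A. dot (sub b c) (sub a c) = \<zero>}))
    \<le> real (card A) ^ 3 / real q + sqrt (real q ^ n / real q) * real (card A) ^ 2"
proof -
  have fA: "finite A" using A finite_V finite_subset by blast
  have IA: "I \<subseteq> A \<times> A" by (auto simp: I_def)
  have fI: "finite I" using IA fA finite_subset by blast
  have AV: "a \<in> A \<Longrightarrow> a \<in> V n" for a using A by auto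
  define w where "w = (\<lambda>(a, c). sub a c)"
  \<comment> \<open>With this right-hand side, \<open>dot b w = t\<close> says that
    \<open>b - c\<close> is orthogonal to \<open>a - c\<close>.\<close>
  define t where "t = (\<lambda>(a, c). dot c (sub a c))"
  define D where "D = {(i, j) \<in> I \<times> I. \<exists>l\<in>carrier R. w j = scale l (w i) \<and> t j = l \<otimes> t i}"
  have ne: "w i \<noteq> nul n" if "i \<in> I" for i
    using that AV dot_nul[of "nul n" n] by (auto simp: I_def w_def)
  have "card D \<le> card (A \<times> A \<times> A)"
  proof (rule card_inj_on_le[of "\<lambda>((a, c), (a', c')). (a, c, a')"])
    show "inj_on (\<lambda>((a, c), (a', c')). (a, c, a')) D"
    proof -
      have "c1 = c2" if 1: "((a, c), (a', c1)) \<in> D" and 2: "((a, c), (a', c2)) \<in> D" for a c a' c1 c2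
      proof -
        have V: "a \<in> V n" "c \<in> V n" "a' \<in> V n" "c1 \<in> V n" "c2 \<in> V n"
          and ns: "dot (sub a c) (sub a c) \<noteq> \<zero>" and nz: "sub a' c1 \<noteq> nul n" "sub a' c2 \<noteq> nul n"
          using 1 2 AV ne[of "(a', c1)"] ne[of "(a', c2)"] by (auto simp: D_def I_def w_def)
        define u where "u = sub a c"
        have u: "u \<in> V n" "dot u u \<in> carrier R" "dot u u \<noteq> \<zero>" using V ns by (auto simp: u_def intro!: dot_closed[of _ n])
        \<comment> \<open>pairing \<open>a' - c' = l u\<close> with \<open>u\<close> determines \<open>l\<close>, because \<open>u\<close> is not isotropic\<close>
        have l: "l \<otimes> dot u u = dot a' u \<ominus> dot c u"
          if c': "c' \<in> V n" "l \<in> carrier R" "sub a' c' = scale l u" "dot c' (sub a' c') = l \<otimes> dot c u"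
            "sub a' c' \<noteq> nul n" for c' l
        proof -
          have cl: "dot c' u \<in> carrier R" "dot c u \<in> carrier R" using c' u V by auto
          have "l \<noteq> \<zero>"
          proof
            assume "l = \<zero>"
            moreover have "scale \<zero> u = nul n" using u(1)
              by (induction n arbitrary: u) (auto simp: vecs_0 vecs_Suc)
            ultimately show False using c' by simp
          qed
          \<comment> \<open>The two equations are proportional with factor \<open>l\<close>. As
            \<open>l\<close> is nonzero it cancels, so \<open>c'\<close> lies on the hyperplane
            through \<open>c\<close> with normal \<open>u\<close>.\<close>
          moreover have "l \<otimes> dot c' u = l \<otimes> dot c u"
            using c' u by (simp add: dot_scale_right[where n = n])
          ultimately have "dot c' u = dot c u" using cl c' m_lcancel by simp
          moreover have "l \<otimes> dot u u = dot a' u \<ominus> dot c' u"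
            using c' u V by (metis dot_scale_left dot_sub_left)
          ultimately show ?thesis by simp
        qed
        obtain l1 where l1: "l1 \<in> carrier R" "sub a' c1 = scale l1 u" "dot c1 (sub a' c1) = l1 \<otimes> dot c u"
          using 1 by (auto simp: D_def w_def t_def u_def)
        obtain l2 where l2: "l2 \<in> carrier R" "sub a' c2 = scale l2 u" "dot c2 (sub a' c2) = l2 \<otimes> dot c u"
          using 2 by (auto simp: D_def w_def t_def u_def)
        have "l1 \<otimes> dot u u = l2 \<otimes> dot u u"
          using l[OF V(4) l1 nz(1)] l[OF V(5) l2 nz(2)] by simp
        then have "l1 = l2" using l1(1) l2(1) u m_rcancel by simp
        then have "sub a' c1 = sub a' c2" using l1 l2 by simp
        then have "add (sub a' c1) c1 = add (sub a' c1) c2" using V sub_add[of a' n] by metis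
        then show ?thesis using V add_left_cancel[of c1 n c2 "sub a' c1"] by simp
      qed
      then show ?thesis by (auto simp: inj_on_def)
    qed
    show "(\<lambda>((a, c), (a', c')). (a, c, a')) ` D \<subseteq> A \<times> A \<times> A" using IA by (auto simp: D_def)
  qed (use fA in auto)
  then have "real (card D) \<le> real (card A * (card A * card A))"
    by (simp only: card_cartesian_product of_nat_le_iff)
  then have D: "real (card D) \<le> real (card A) ^ 3" by (simp add: power3_eq_cube)
  have "card I \<le> card (A \<times> A)" using IA fA by (intro card_mono) auto
  then have "real (card I) \<le> real (card A * card A)" by (simp only: card_cartesian_product of_nat_le_iff)
  then have cI: "real (card I) \<le> real (card A) ^ 2" by (simp add: power2_eq_square)
  have "(\<Sum>(a, c)\<in>I. real (card {b \<in> A. dot (sub b c) (sub a c) = \<zero>})) = (\<Sum>i\<in>I. real (card {b \<in> A. dot b (w i) = t i}))"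
  proof (rule sum.cong[OF refl])
    fix i assume "i \<in> I"
    then obtain a c where i: "i = (a, c)" and V: "a \<in> V n" "c \<in> V n" using IA AV by auto
    have "dot (sub b c) (sub a c) = \<zero> \<longleftrightarrow> dot b (w (a, c)) = t (a, c)" if "b \<in> A" for b
      using AV[OF that] V dot_closed[of b n "sub a c"] dot_closed[of c n "sub a c"]
      by (simp add: w_def t_def dot_sub_left[where n = n])
    then show "(case i of (a, c) \<Rightarrow> real (card {b \<in> A. dot (sub b c) (sub a c) = \<zero>})) = real (card {b \<in> A. dot b (w i) = t i})"
      unfolding i prod.case by (intro arg_cong[where f = "\<lambda>S. real (card S)"]) auto
  qed
  also have "\<dots> \<le> real (card A) * real (card I) / real q + sqrt (real (card A) * (real q ^ n / real q * real (card D)))"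
    unfolding D_def
  proof (rule incidence_bound[OF fI A _ ne])
    show "w i \<in> V n" "t i \<in> carrier R" if "i \<in> I" for i
      using that IA AV by (auto simp: w_def t_def intro!: dot_closed[of _ n])
  qed
  also have "\<dots> \<le> real (card A) * real (card A) ^ 2 / real q + sqrt (real (card A) * (real q ^ n / real q * real (card A) ^ 3))"
    using cI D by (intro add_mono divide_right_mono mult_left_mono real_sqrt_le_mono) auto
  also have "real (card A) * (real q ^ n / real q * real (card A) ^ 3) = (real q ^ n / real q) * (real (card A) ^ 2) ^ 2"
    by (simp add: power_numeral_reduce)
  also have "sqrt \<dots> = sqrt (real q ^ n / real q) * real (card A) ^ 2"
    by (simp only: real_sqrt_mult real_sqrt_abs) simp
  finally show ?thesis by (simp add: power_numeral_reduce)
qed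

section \<open>Counting pairs of field elements\<close>

lemma card_mult_eq:
  assumes "t \<in> carrier R" "t \<noteq> \<zero>"
  shows "card {(u, w) \<in> carrier R \<times> carrier R. u \<otimes> w = t} = q - 1"
proof -
  have "{(u, w) \<in> carrier R \<times> carrier R. u \<otimes> w = t} = (\<lambda>u. (u, inv u \<otimes> t)) ` (carrier R - {\<zero>})"
  proof (intro equalityI subsetI)
    fix p assume "p \<in> {(u, w) \<in> carrier R \<times> carrier R. u \<otimes> w = t}"
    then obtain u w where p: "p = (u, w)" "u \<in> carrier R" "w \<in> carrier R" "u \<otimes> w = t" by auto
    then have "u \<noteq> \<zero>" using assms by auto
    then have "inv u \<in> carrier R" "inv u \<otimes> u = \<one>" using p field_Units by auto
    then have "inv u \<otimes> t = w" using p by (metis l_one m_assoc)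
    then show "p \<in> (\<lambda>u. (u, inv u \<otimes> t)) ` (carrier R - {\<zero>})" using p \<open>u \<noteq> \<zero>\<close> by auto
  next
    fix p assume "p \<in> (\<lambda>u. (u, inv u \<otimes> t)) ` (carrier R - {\<zero>})"
    then obtain u where p: "p = (u, inv u \<otimes> t)" "u \<in> carrier R" "u \<noteq> \<zero>" by auto
    then have "inv u \<in> carrier R" "u \<otimes> inv u = \<one>" using field_Units by auto
    then have "u \<otimes> (inv u \<otimes> t) = t" using p assms by (metis l_one m_assoc)
    then show "p \<in> {(u, w) \<in> carrier R \<times> carrier R. u \<otimes> w = t}"
      using p assms \<open>inv u \<in> carrier R\<close> by auto
  qed
  then show ?thesis by (simp add: card_image inj_on_def finite_carrier)
qed

lemma card_pairs_eq_sum: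
  "card {(x, y) \<in> carrier R \<times> carrier R. P x y} = (\<Sum>x\<in>carrier R. card {y \<in> carrier R. P x y})"
proof -
  have "{(x, y) \<in> carrier R \<times> carrier R. P x y} = (SIGMA x:carrier R. {y \<in> carrier R. P x y})"
    by auto
  then show ?thesis by (simp add: finite_carrier card_SigmaI)
qed

end

section \<open>Sums of squares\<close>

locale fin_field_3mod4 = fin_field +
  assumes q_mod_4: "q mod 4 = 3"
begin

text \<open>The additive group has odd order \<open>q\<close>, so an element annihilated by 2 and by
  \<open>q\<close> is zero.\<close>

lemma double_eq_zero:
  assumes "x \<in> carrier R" "x \<oplus> x = \<zero>"
  shows "x = \<zero>"
proof -
  note G = a_group and M = group.is_monoid[OF a_group]
  define j where "j = q div 2"
  have q: "q = Suc (2 * j)" using q_mod_4 unfolding j_def by presburger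
  have "x [^]\<^bsub>add_monoid R\<^esub> (2::nat) = \<zero>"
    using assms by (simp add: numeral_2_eq_2 monoid.nat_pow_Suc[OF M] monoid.nat_pow_0[OF M])
  then have "x [^]\<^bsub>add_monoid R\<^esub> (2 * j) = \<zero>"
    using monoid.nat_pow_pow[OF M, of x 2 j] monoid.nat_pow_one[OF M, of j] assms by simp
  moreover have "x [^]\<^bsub>add_monoid R\<^esub> q = \<zero>"
    using group.pow_order_eq_1[OF G, of x] assms by (simp add: order_def)
  ultimately show ?thesis using assms unfolding q by (simp add: monoid.nat_pow_Suc[OF M])
qed

text \<open>For a square root \<open>u\<close> of \<open>-1\<close>, the power
  \<open>u^(q - 1)\<close> is \<open>-1\<close> raised to \<open>(q - 1) / 2\<close>. This exponent
  is odd when \<open>q\<close> is 3 modulo 4, so the power is \<open>-1\<close>, while the order of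
  the multiplicative group forces it to be 1.\<close>

lemma minus_one_not_square:
  assumes "u \<in> carrier R"
  shows "u \<otimes> u \<noteq> \<ominus> \<one>"
proof
  assume u: "u \<otimes> u = \<ominus> \<one>"
  interpret M: group "mult_of R" by (rule field_mult_group)
  define j where "j = q div 4"
  have q: "q - 1 = 2 * (2 * j + 1)" using q_mod_4 unfolding j_def by presburger
  have "u \<noteq> \<zero>" using u by (metis l_null minus_minus minus_zero one_closed one_not_zero zero_closed)
  then have "u [^] (q - 1) = \<one>"
    using M.pow_order_eq_1[of u] assms order_mult_of[OF finite_carrier]
    by (simp add: order_def nat_pow_mult_of)
  moreover have "u [^] (q - 1) = (\<ominus> \<one>) [^] (2 * j + 1)"
  proof -
    have "u [^] (2::nat) = \<ominus> \<one>" using u assms by (simp add: numeral_2_eq_2)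
    then show ?thesis using nat_pow_pow[of u 2 "2 * j + 1"] assms q by simp
  qed
  moreover have "(\<ominus> \<one>) [^] (2 * j + 1) = \<ominus> \<one>"
  proof -
    have "(\<ominus> \<one>) [^] (2::nat) = \<one>" by (simp add: numeral_2_eq_2 l_minus)
    then have "(\<ominus> \<one>) [^] (2 * j) = \<one>" using nat_pow_pow[of "\<ominus> \<one>" 2 j] by (simp add: nat_pow_one)
    then show ?thesis by simp
  qed
  ultimately have "\<one> = \<ominus> \<one>" by simp
  then have "\<one> \<oplus> \<one> = \<zero>" by (metis one_closed r_neg)
  then show False using double_eq_zero[of \<one>] by simp
qed

text \<open>If \<open>y\<close> were nonzero, \<open>x / y\<close> would be a square root of
  \<open>-1\<close>. Exchanging the roles gives the same for \<open>x\<close>: the plane is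
  anisotropic.\<close>

lemma sum_two_squares_eq_zero:
  assumes "x \<in> carrier R" "y \<in> carrier R" "x \<otimes> x \<oplus> y \<otimes> y = \<zero>"
  shows "y = \<zero>"
proof (rule ccontr)
  assume y: "y \<noteq> \<zero>"
  then have i: "inv y \<in> carrier R" "y \<otimes> inv y = \<one>" using assms field_Units by auto
  have "(x \<otimes> inv y) \<otimes> (x \<otimes> inv y) = (x \<otimes> x) \<otimes> (inv y \<otimes> inv y)" using assms i by (simp add: m_ac)
  also have "x \<otimes> x = \<ominus> (y \<otimes> y)" using assms by (metis m_closed minus_equality minus_minus)
  also have "\<ominus> (y \<otimes> y) \<otimes> (inv y \<otimes> inv y) = \<ominus> ((y \<otimes> inv y) \<otimes> (y \<otimes> inv y))"
    using assms i(1) by (simp add: m_ac l_minus r_minus)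
  finally show False using minus_one_not_square[of "x \<otimes> inv y"] assms i by simp
qed

text \<open>For \<open>t \<noteq> 0\<close> at most one of \<open>t\<close> and \<open>-t\<close> is
  a square, and a square has at most two roots, so 2 is an upper bound. Averaging over all
  \<open>t\<close> shows that it is always attained.\<close>

lemma card_square_roots:
  assumes "t \<in> carrier R"
  shows "card {y \<in> carrier R. y \<otimes> y = t} + card {y \<in> carrier R. y \<otimes> y = \<ominus> t} = 2"
proof -
  define f where "f t = card {y \<in> carrier R. y \<otimes> y = t}" for t
  have f2: "f t \<le> 2" for t
  proof (cases "{y \<in> carrier R. y \<otimes> y = t} = {}")
    case False
    then obtain z where z: "z \<in> carrier R" "z \<otimes> z = t" by auto
    have "{y \<in> carrier R. y \<otimes> y = t} \<subseteq> {z, \<ominus> z}"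
    proof
      fix y assume "y \<in> {y \<in> carrier R. y \<otimes> y = t}"
      then have y: "y \<in> carrier R" "y \<otimes> y = z \<otimes> z" using z by auto
      have "(y \<ominus> z) \<otimes> (y \<oplus> z) = y \<otimes> y \<ominus> z \<otimes> z" using y(1) z(1) by algebra
      then have "(y \<ominus> z) \<otimes> (y \<oplus> z) = \<zero>" using y z m_closed[of z z] by simp
      then have "y \<ominus> z = \<zero> \<or> y \<oplus> z = \<zero>" using y(1) z(1) integral_iff[of "y \<ominus> z" "y \<oplus> z"] by simp
      then show "y \<in> {z, \<ominus> z}" using y z by (auto simp: minus_equality)
    qed
    then have "f t \<le> card {z, \<ominus> z}" unfolding f_def by (intro card_mono) auto
    also have "\<dots> \<le> 2" by (simp add: card_insert_if)
    finally show ?thesis .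
  qed (simp only: f_def card.empty)
  have f_zero: "f \<zero> = 1"
  proof -
    have "{y \<in> carrier R. y \<otimes> y = \<zero>} = {\<zero>}" using integral by auto
    then show ?thesis by (simp add: f_def)
  qed
  have le: "f t + f (\<ominus> t) \<le> 2" if t: "t \<in> carrier R" for t
  proof (cases "f t = 0 \<or> f (\<ominus> t) = 0")
    case True
    then show ?thesis using f2[of t] f2[of "\<ominus> t"] by auto
  next
    case False
    then obtain x y where "x \<in> carrier R" "y \<in> carrier R" "x \<otimes> x = t" "y \<otimes> y = \<ominus> t"
      unfolding f_def by (auto simp: finite_carrier)
    then have "t = \<zero>" using sum_two_squares_eq_zero[of x y] t r_neg[OF t]
      by (metis l_null minus_minus minus_zero zero_closed)
    then show ?thesis using f_zero by simp
  qed
  have sum_f: "(\<Sum>t\<in>carrier R. f t) = q"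
  proof -
    have "q = card (\<Union>t\<in>carrier R. {y \<in> carrier R. y \<otimes> y = t})"
      by (intro arg_cong[where f = card]) auto
    also have "\<dots> = (\<Sum>t\<in>carrier R. f t)" unfolding f_def
      by (rule card_UN_disjoint) (auto simp: finite_carrier)
    finally show ?thesis by simp
  qed
  have "(\<Sum>t\<in>carrier R. f (\<ominus> t)) = (\<Sum>t\<in>carrier R. f t)"
    by (rule sum.reindex_bij_witness[of _ "\<lambda>t. \<ominus> t" "\<lambda>t. \<ominus> t"]) auto
  \<comment> \<open>The deficits are nonnegative with sum zero, so each vanishes. Integers are used
    because subtraction of naturals truncates.\<close>
  then have "(\<Sum>t\<in>carrier R. 2 - (int (f t) + int (f (\<ominus> t)))) = 0"
    using sum_f by (simp add: sum_subtractf sum.distrib flip: of_nat_sum)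
  then have "2 - (int (f t) + int (f (\<ominus> t))) = 0"
    using assms le finite_carrier
    by (subst (asm) sum_nonneg_eq_0_iff) (auto simp: of_nat_add[symmetric] simp del: of_nat_add)
  then show ?thesis unfolding f_def by linarith
qed

text \<open>The substitution \<open>u = x - y\<close>, \<open>w = x + y\<close> is a bijection,
  since doubling is injective, and turns the equation into \<open>u w = t\<close>.\<close>

lemma card_difference_two_squares:
  assumes "t \<in> carrier R" "t \<noteq> \<zero>"
  shows "card {(x, y) \<in> carrier R \<times> carrier R. x \<otimes> x \<ominus> y \<otimes> y = t} = q - 1"
proof -
  define \<phi> where "\<phi> = (\<lambda>(x, y). (x \<ominus> y, x \<oplus> y))"
  have inj: "inj_on \<phi> (carrier R \<times> carrier R)"
  proof (rule inj_onI, clarsimp simp: \<phi>_def)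
    fix x y x' y' assume *: "x \<in> carrier R" "y \<in> carrier R" "x' \<in> carrier R" "y' \<in> carrier R"
      "x \<ominus> y = x' \<ominus> y'" "x \<oplus> y = x' \<oplus> y'"
    have "(x \<ominus> x') \<oplus> (x \<ominus> x') = ((x \<ominus> y) \<ominus> (x' \<ominus> y')) \<oplus> ((x \<oplus> y) \<ominus> (x' \<oplus> y'))"
      using *(1-4) by algebra
    also have "\<dots> = \<zero>" unfolding *(5,6) using *(1-4) by (simp add: a_minus_def r_neg)
    finally have "(x \<ominus> x') \<oplus> (x \<ominus> x') = \<zero>" .
    then have "x \<ominus> x' = \<zero>" using *(1,3) double_eq_zero[of "x \<ominus> x'"] by simp
    then have "x = x'" using *(1,3) by simp
    then show "x = x' \<and> y = y'" using *(1-4,6) by simp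
  qed
  have sub: "\<phi> ` (carrier R \<times> carrier R) \<subseteq> carrier R \<times> carrier R" by (auto simp: \<phi>_def)
  have surj: "\<phi> ` (carrier R \<times> carrier R) = carrier R \<times> carrier R"
    by (rule endo_inj_surj) (use inj sub finite_carrier in auto)
  have prod: "(x \<ominus> y) \<otimes> (x \<oplus> y) = x \<otimes> x \<ominus> y \<otimes> y" if "x \<in> carrier R" "y \<in> carrier R" for x y
    using that by algebra
  have "{(u, w) \<in> carrier R \<times> carrier R. u \<otimes> w = t} =
      \<phi> ` {(x, y) \<in> carrier R \<times> carrier R. x \<otimes> x \<ominus> y \<otimes> y = t}"
  proof (intro equalityI subsetI)
    fix p assume p: "p \<in> {(u, w) \<in> carrier R \<times> carrier R. u \<otimes> w = t}"
    then have "p \<in> \<phi> ` (carrier R \<times> carrier R)" unfolding surj by auto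
    then obtain x y where "x \<in> carrier R" "y \<in> carrier R" "p = \<phi> (x, y)" by auto
    then show "p \<in> \<phi> ` {(x, y) \<in> carrier R \<times> carrier R. x \<otimes> x \<ominus> y \<otimes> y = t}"
      using p prod by (auto simp: \<phi>_def)
  qed (use prod in \<open>auto simp: \<phi>_def\<close>)
  moreover have "inj_on \<phi> {(x, y) \<in> carrier R \<times> carrier R. x \<otimes> x \<ominus> y \<otimes> y = t}"
    using inj by (rule inj_on_subset) auto
  ultimately show ?thesis using card_mult_eq[OF assms] by (simp add: card_image)
qed

text \<open>For \<open>t = 0\<close> the plane is anisotropic. For \<open>t \<noteq> 0\<close>, fix
  \<open>x\<close>: by \<open>card_square_roots\<close> the equations for the sum and for the
  difference of squares together have two solutions \<open>y\<close>. Both counts thus add up to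
  \<open>2q\<close>, and the difference accounts for \<open>q - 1\<close>.\<close>

lemma card_sum_two_squares:
  assumes "t \<in> carrier R"
  shows "card {(x, y) \<in> carrier R \<times> carrier R. x \<otimes> x \<oplus> y \<otimes> y = t} = (if t = \<zero> then 1 else q + 1)"
proof (cases "t = \<zero>")
  case True
  have "{(x, y) \<in> carrier R \<times> carrier R. x \<otimes> x \<oplus> y \<otimes> y = t} = {(\<zero>, \<zero>)}"
  proof -
    have "x = \<zero> \<and> y = \<zero>" if "x \<in> carrier R" "y \<in> carrier R" "x \<otimes> x \<oplus> y \<otimes> y = \<zero>" for x y
      using that sum_two_squares_eq_zero[of x y] sum_two_squares_eq_zero[of y x] by (simp add: a_comm)
    then show ?thesis using True by auto
  qed
  then show ?thesis using True by simp
next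
  case False
  have e1: "x \<otimes> x \<oplus> y \<otimes> y = t \<longleftrightarrow> y \<otimes> y = t \<ominus> x \<otimes> x" if "x \<in> carrier R" "y \<in> carrier R" for x y
    using that assms by (metis a_comm add.inv_solve_right' a_minus_def m_closed)
  have e2: "x \<otimes> x \<ominus> y \<otimes> y = t \<longleftrightarrow> y \<otimes> y = \<ominus> (t \<ominus> x \<otimes> x)" if "x \<in> carrier R" "y \<in> carrier R" for x y
  proof
    assume "x \<otimes> x \<ominus> y \<otimes> y = t"
    then have "\<ominus> (t \<ominus> x \<otimes> x) = \<ominus> ((x \<otimes> x \<ominus> y \<otimes> y) \<ominus> x \<otimes> x)" by simp
    also have "\<dots> = y \<otimes> y" using that by algebra
    finally show "y \<otimes> y = \<ominus> (t \<ominus> x \<otimes> x)" by simp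
  next
    assume "y \<otimes> y = \<ominus> (t \<ominus> x \<otimes> x)"
    then have "x \<otimes> x \<ominus> y \<otimes> y = x \<otimes> x \<ominus> \<ominus> (t \<ominus> x \<otimes> x)" by simp
    also have "\<dots> = t" using that assms by algebra
    finally show "x \<otimes> x \<ominus> y \<otimes> y = t" .
  qed
  have "card {(x, y) \<in> carrier R \<times> carrier R. x \<otimes> x \<oplus> y \<otimes> y = t} +
      card {(x, y) \<in> carrier R \<times> carrier R. x \<otimes> x \<ominus> y \<otimes> y = t} =
      (\<Sum>x\<in>carrier R. card {y \<in> carrier R. y \<otimes> y = t \<ominus> x \<otimes> x} + card {y \<in> carrier R. y \<otimes> y = \<ominus> (t \<ominus> x \<otimes> x)})"
    unfolding card_pairs_eq_sum sum.distrib
    by (intro arg_cong2[where f = "(+)"] sum.cong arg_cong[where f = card]) (use e1 e2 in auto)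
  also have "\<dots> = (\<Sum>x\<in>carrier R. 2)"
    using assms by (intro sum.cong card_square_roots) auto
  finally show ?thesis using card_difference_two_squares[OF assms False] False q_ge_2 by simp
qed

section \<open>Numbers of representations by sums of squares\<close>

definition rep :: "nat \<Rightarrow> 'a \<Rightarrow> nat" where
  "rep n t = card {x \<in> V n. dot x x = t}"

text \<open>Split off two coordinates: a remainder \<open>x\<close> extends in \<open>q + 1\<close>
  ways, or in one way if \<open>dot x x = t\<close>. Adding \<open>q * rep n t\<close> repairs
  exactly this deficit.\<close>

lemma rep_add_2:
  assumes t: "t \<in> carrier R"
  shows "rep (n + 2) t + q * rep n t = (q + 1) * q ^ n"
proof -
  define B where "B x = {(a, b) \<in> carrier R \<times> carrier R. a \<otimes> a \<oplus> b \<otimes> b = t \<ominus> dot x x}" for x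
  have eq: "a \<otimes> a \<oplus> (b \<otimes> b \<oplus> dot x x) = t \<longleftrightarrow> a \<otimes> a \<oplus> b \<otimes> b = t \<ominus> dot x x"
    if "a \<in> carrier R" "b \<in> carrier R" "x \<in> V n" for a b x
  proof -
    have "dot x x \<in> carrier R" using that by auto
    then show ?thesis using that t by (metis a_assoc a_closed add.inv_solve_right' a_minus_def m_closed)
  qed
  have "{x \<in> V (n + 2). dot x x = t} = (\<lambda>(x, a, b). a # b # x) ` (SIGMA x:V n. B x)"
  proof (intro equalityI subsetI)
    fix p assume p: "p \<in> {x \<in> V (n + 2). dot x x = t}"
    then obtain a b x where "p = a # b # x" "a \<in> carrier R" "b \<in> carrier R" "x \<in> V n"
      by (auto simp: vecs_Suc)
    then show "p \<in> (\<lambda>(x, a, b). a # b # x) ` (SIGMA x:V n. B x)"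
      using p eq[of a b x] by (intro image_eqI[of _ _ "(x, a, b)"]) (auto simp: B_def)
  next
    fix p assume "p \<in> (\<lambda>(x, a, b). a # b # x) ` (SIGMA x:V n. B x)"
    then obtain a b x where "p = a # b # x" "a \<in> carrier R" "b \<in> carrier R" "x \<in> V n"
      "a \<otimes> a \<oplus> b \<otimes> b = t \<ominus> dot x x"
      by (auto simp: B_def)
    then show "p \<in> {x \<in> V (n + 2). dot x x = t}" using eq[of a b x] by (simp add: vecs_Cons)
  qed
  moreover have "inj_on (\<lambda>(x, a, b). a # b # x) (SIGMA x:V n. B x)" by (auto simp: inj_on_def)
  moreover have fB: "finite (B x)" for x
    unfolding B_def by (rule finite_subset[of _ "carrier R \<times> carrier R"]) (auto simp: finite_carrier)
  ultimately have "rep (n + 2) t = (\<Sum>x\<in>V n. card (B x))"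
    unfolding rep_def by (simp add: card_image card_SigmaI)
  also have "\<dots> = (\<Sum>x\<in>V n. if dot x x = t then 1 else q + 1)"
  proof (rule sum.cong)
    fix x assume x: "x \<in> V n"
    then have "t \<ominus> dot x x = \<zero> \<longleftrightarrow> dot x x = t" using t by auto
    then show "card (B x) = (if dot x x = t then 1 else q + 1)"
      unfolding B_def using card_sum_two_squares[of "t \<ominus> dot x x"] x t by simp
  qed simp
  finally have "rep (n + 2) t + q * rep n t =
      (\<Sum>x\<in>V n. (if dot x x = t then 1 else q + 1) + q * of_bool (dot x x = t))"
    unfolding rep_def by (simp add: sum.distrib Int_def flip: sum_distrib_left)
  also have "\<dots> = (\<Sum>x\<in>V n. q + 1)" by (intro sum.cong) auto
  finally show ?thesis by (simp add: card_V)
qed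

text \<open>This solves the recurrence of \<open>rep_add_2\<close> from dimension 0. Each
  anisotropic plane contributes a factor \<open>-q\<close> to the deviation from the average; for
  odd \<open>m\<close> zero is therefore represented less often than average.\<close>

lemma rep_eq:
  assumes "t \<in> carrier R"
  shows "real (rep (2 * m) t) = (real q ^ (2 * m) - (- real q) ^ m) / real q + (- real q) ^ m * of_bool (t = \<zero>)"
proof (induction m)
  case 0
  have "{x \<in> V 0. dot x x = t} = (if t = \<zero> then {[]} else {})" by (auto simp: vecs_0)
  then show ?case by (simp add: rep_def)
next
  case (Suc m)
  have "real (rep (2 * m + 2) t) + real q * real (rep (2 * m) t) = (real q + 1) * real q ^ (2 * m)"
    using arg_cong[OF rep_add_2[OF assms, of "2 * m"], of real]
    by (simp add: algebra_simps)
  moreover have "real q > 0" using q_ge_2 by simp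
  ultimately show ?case unfolding Suc.IH by (simp add: field_simps power2_eq_square)
qed

end

section \<open>Isotropic vectors in a hyperplane\<close>

context fin_field_3mod4
begin

text \<open>A line in the isotropic direction \<open>z\<close> inside \<open>dot v z = c \<noteq> 0\<close> meets the quadric exactly once.\<close>
lemma card_isotropic_off_tangent:
  assumes z: "z \<in> V n" "z \<noteq> nul n" "dot z z = \<zero>" and c: "c \<in> carrier R" "c \<noteq> \<zero>"
  shows "q ^ 2 * card {v \<in> V n. dot v v = \<zero> \<and> dot v z = c} = q ^ n"
proof -
  define X where "X = {v \<in> V n. dot v z = c}"
  have fX: "finite X" by (simp add: X_def)
  \<comment> \<open>This is the coefficient of \<open>l\<close> in the norm of
    \<open>v + l z\<close>; being nonzero, it gives each line exactly one isotropic point.\<close>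
  have cc: "c \<oplus> c \<noteq> \<zero>" using double_eq_zero c by blast
  have sq: "dot (add v (scale l z)) (add v (scale l z)) = dot v v \<oplus> l \<otimes> (c \<oplus> c)"
    if "v \<in> X" "l \<in> carrier R" for v l
    using that z c dot_add_scale_self[of v n z l] dot_closed[of v n v] by (simp add: X_def)
  have tX: "add v (scale l z) \<in> X" if "v \<in> X" "l \<in> carrier R" for v l
    using that z c by (simp add: X_def dot_add_left[where n = n] dot_scale_left[where n = n])
  have "card X = (\<Sum>v\<in>X. card {l \<in> carrier R. dot v v \<oplus> l \<otimes> (c \<oplus> c) = \<zero>})"
  proof -
    have "card {l \<in> carrier R. dot v v \<oplus> l \<otimes> (c \<oplus> c) = \<zero>} = 1" if "v \<in> X" for v
      using that c cc by (intro card_linear_solve) (auto simp: X_def)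
    then show ?thesis by simp
  qed
  also have "\<dots> = (\<Sum>v\<in>X. card {l \<in> carrier R. dot (add v (scale l z)) (add v (scale l z)) = \<zero>})"
    using sq by (intro sum.cong arg_cong[where f = card]) auto
  also have "\<dots> = (\<Sum>l\<in>carrier R. card {v \<in> X. dot (add v (scale l z)) (add v (scale l z)) = \<zero>})"
    by (rule sum_card_swap[OF fX finite_carrier])
  \<comment> \<open>Translation by \<open>scale l z\<close> permutes \<open>X\<close>, because
    \<open>z\<close> is orthogonal to itself. Hence every \<open>l\<close> contributes the same
    count.\<close>
  also have "\<dots> = (\<Sum>l\<in>carrier R. card {v \<in> V n. dot v v = \<zero> \<and> dot v z = c})"
  proof (rule sum.cong)
    fix l assume l: "l \<in> carrier R"
    have inj: "inj_on (\<lambda>v. add v (scale l z)) X"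
      using l z by (auto simp: inj_on_def X_def add_right_cancel[where n = n])
    have "{v \<in> V n. dot v v = \<zero> \<and> dot v z = c} =
       (\<lambda>v. add v (scale l z)) ` {v \<in> X. dot (add v (scale l z)) (add v (scale l z)) = \<zero>}" (is "_ = ?f ` _")
    proof (intro equalityI subsetI)
      fix v assume v: "v \<in> {v \<in> V n. dot v v = \<zero> \<and> dot v z = c}"
      define u where "u = add v (scale (\<ominus> l) z)"
      have "v = ?f u" using v l z scale_uminus_add[of v n z l] by (simp add: u_def)
      moreover have "u \<in> X" using v l tX[of v "\<ominus> l"] by (simp add: u_def X_def)
      ultimately show "v \<in> ?f ` {v \<in> X. dot (?f v) (?f v) = \<zero>}" using v by blast
    qed (use tX[OF _ l] in \<open>auto simp: X_def\<close>)
    moreover have "inj_on ?f {v \<in> X. dot (?f v) (?f v) = \<zero>}"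
      using inj by (rule inj_on_subset) auto
    ultimately show "card {v \<in> X. dot (?f v) (?f v) = \<zero>} = card {v \<in> V n. dot v v = \<zero> \<and> dot v z = c}"
      by (simp add: card_image)
  qed simp
  finally have "card X = q * card {v \<in> V n. dot v v = \<zero> \<and> dot v z = c}" by simp
  then show ?thesis using card_hyperplane[OF z(1,2) c(1)] by (simp add: X_def power2_eq_square)
qed

text \<open>Sort the isotropic vectors by the value of \<open>dot v z\<close>: each of the
  \<open>q - 1\<close> nonzero values is taken \<open>q^(n - 2)\<close> times, and the rest is
  orthogonal to \<open>z\<close>.\<close>

lemma card_isotropic_tangent:
  assumes z: "z \<in> V n" "z \<noteq> nul n" "dot z z = \<zero>"
  shows "real (card {v \<in> V n. dot v v = \<zero> \<and> dot v z = \<zero>}) =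
     real (rep n \<zero>) - (real q - 1) * (real q ^ n / real q ^ 2)"
proof -
  define h where "h c = card {v \<in> V n. dot v v = \<zero> \<and> dot v z = c}" for c
  have q0: "real q > 0" using q_ge_2 by simp
  have "rep n \<zero> = card (\<Union>c\<in>carrier R. {v \<in> V n. dot v v = \<zero> \<and> dot v z = c})"
    unfolding rep_def using z by (intro arg_cong[where f = card]) auto
  also have "\<dots> = (\<Sum>c\<in>carrier R. h c)" unfolding h_def
    by (rule card_UN_disjoint) (auto simp: finite_carrier)
  also have "\<dots> = h \<zero> + (\<Sum>c\<in>carrier R - {\<zero>}. h c)"
    by (rule sum.remove) (auto simp: finite_carrier)
  finally have "real (rep n \<zero>) = real (h \<zero>) + (\<Sum>c\<in>carrier R - {\<zero>}. real (h c))" by simp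
  also have "(\<Sum>c\<in>carrier R - {\<zero>}. real (h c)) = (\<Sum>c\<in>carrier R - {\<zero>}. real q ^ n / real q ^ 2)"
  proof (rule sum.cong)
    fix c assume "c \<in> carrier R - {\<zero>}"
    then have "real (q ^ 2 * h c) = real (q ^ n)"
      using card_isotropic_off_tangent[OF z, of c] by (simp add: h_def)
    then show "real (h c) = real q ^ n / real q ^ 2" using q0 by (simp add: field_simps)
  qed simp
  also have "\<dots> = (real q - 1) * (real q ^ n / real q ^ 2)"
    using q_ge_2 by (simp add: finite_carrier of_nat_diff)
  finally show ?thesis by (simp add: h_def)
qed

text \<open>Count in two ways the zeros of \<open>dot v v + \<tau>(l\<^sup>2 + \<mu>\<^sup>2)\<close> with \<open>v\<close> orthogonal to \<open>z\<close>, where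
  \<open>\<tau> = dot z z\<close>: the term \<open>\<tau> l\<^sup>2\<close> either completes \<open>v\<close> to the vector \<open>v + l z\<close> of the full space or
  joins \<open>\<tau> \<mu>\<^sup>2\<close> to form a multiple of a sum of two squares.\<close>
lemma card_isotropic_nontangent:
  assumes z: "z \<in> V (2 * m)" "dot z z \<noteq> \<zero>"
  shows "real (card {v \<in> V (2 * m). dot v v = \<zero> \<and> dot v z = \<zero>}) = real q ^ (2 * m) / real q ^ 2"
proof -
  define n where "n = 2 * m"
  have zn: "z \<in> V n" using z by (simp add: n_def)
  define \<tau> where "\<tau> = dot z z"
  have \<tau>: "\<tau> \<in> carrier R" "\<tau> \<noteq> \<zero>" using z by (auto simp: \<tau>_def)
  have i\<tau>: "inv \<tau> \<in> carrier R" "\<tau> \<otimes> inv \<tau> = \<one>" "inv \<tau> \<otimes> \<tau> = \<one>" using \<tau> field_Units by auto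
  define W where "W = {v \<in> V n. dot v z = \<zero>}"
  define g where "g = card {v \<in> V n. dot v v = \<zero> \<and> dot v z = \<zero>}"
  have q0: "real q > 0" using q_ge_2 by simp
  have fW: "finite W" by (simp add: W_def)
  have "z \<noteq> nul n" using z zn dot_nul by auto
  then have cW: "q * card W = q ^ n" using card_hyperplane[OF zn, of \<zero>] by (simp add: W_def)
  define T where "T = card {(p, \<mu>) \<in> (W \<times> carrier R) \<times> carrier R.
    (case p of (v, l) \<Rightarrow> dot v v \<oplus> \<tau> \<otimes> (l \<otimes> l \<oplus> \<mu> \<otimes> \<mu>) = \<zero>)}"
  \<comment> \<open>First count: for fixed \<open>v\<close> the pairs \<open>(l, \<mu>)\<close>
    solve a sum-of-two-squares equation, with \<open>q + 1\<close> solutions, or one if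
    \<open>v\<close> is isotropic.\<close>
  have T1: "T + q * g = (q + 1) * card W"
  proof -
    define B where "B v = {(l, \<mu>) \<in> carrier R \<times> carrier R. l \<otimes> l \<oplus> \<mu> \<otimes> \<mu> = \<ominus> dot v v \<otimes> inv \<tau>}" for v
    have eq: "dot v v \<oplus> \<tau> \<otimes> s = \<zero> \<longleftrightarrow> s = \<ominus> dot v v \<otimes> inv \<tau>" if "v \<in> W" "s \<in> carrier R" for v s
    proof -
      have c: "dot v v \<in> carrier R" using that by (auto simp: W_def)
      show ?thesis
      proof
        assume "dot v v \<oplus> \<tau> \<otimes> s = \<zero>"
        then have "\<ominus> dot v v = s \<otimes> \<tau>" using c that \<tau> by (metis a_comm m_closed m_comm minus_equality)
        then show "s = \<ominus> dot v v \<otimes> inv \<tau>" using that \<tau> i\<tau> by (simp add: m_assoc)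
      next
        assume "s = \<ominus> dot v v \<otimes> inv \<tau>"
        then have "\<tau> \<otimes> s = \<ominus> dot v v \<otimes> (inv \<tau> \<otimes> \<tau>)" using c \<tau>(1) i\<tau>(1) by (simp add: m_ac)
        then show "dot v v \<oplus> \<tau> \<otimes> s = \<zero>" using c i\<tau> by (simp add: r_neg)
      qed
    qed
    have B_iff: "(l, \<mu>) \<in> B v \<longleftrightarrow> l \<in> carrier R \<and> \<mu> \<in> carrier R \<and> dot v v \<oplus> \<tau> \<otimes> (l \<otimes> l \<oplus> \<mu> \<otimes> \<mu>) = \<zero>"
      if "v \<in> W" for v l \<mu>
      using eq[OF that, of "l \<otimes> l \<oplus> \<mu> \<otimes> \<mu>"] by (auto simp: B_def)
    have "T = card (SIGMA v:W. B v)"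
      unfolding T_def
    proof (rule bij_betw_same_card[of "\<lambda>((v, l), \<mu>). (v, l, \<mu>)"], rule bij_betw_imageI)
      show "inj_on (\<lambda>((v, l), \<mu>). (v, l, \<mu>)) {(p, \<mu>) \<in> (W \<times> carrier R) \<times> carrier R.
        case p of (v, l) \<Rightarrow> dot v v \<oplus> \<tau> \<otimes> (l \<otimes> l \<oplus> \<mu> \<otimes> \<mu>) = \<zero>}"
        by (auto simp: inj_on_def)
      show "(\<lambda>((v, l), \<mu>). (v, l, \<mu>)) ` {(p, \<mu>) \<in> (W \<times> carrier R) \<times> carrier R.
        case p of (v, l) \<Rightarrow> dot v v \<oplus> \<tau> \<otimes> (l \<otimes> l \<oplus> \<mu> \<otimes> \<mu>) = \<zero>} = (SIGMA v:W. B v)"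
        (is "?f ` ?S = _")
      proof (intro equalityI subsetI)
        fix p assume "p \<in> (SIGMA v:W. B v)"
        then obtain v l \<mu> where "p = (v, l, \<mu>)" "v \<in> W" "(l, \<mu>) \<in> B v" by auto
        then show "p \<in> ?f ` ?S" using B_iff[of v l \<mu>] by (intro image_eqI[of _ _ "((v, l), \<mu>)"]) auto
      qed (use B_iff in auto)
    qed
    also have "\<dots> = (\<Sum>v\<in>W. card (B v))"
    proof -
      have "finite (B v)" for v
        unfolding B_def by (rule finite_subset[of _ "carrier R \<times> carrier R"]) (auto simp: finite_carrier)
      then show ?thesis using fW by (intro card_SigmaI) auto
    qed
    also have "\<dots> = (\<Sum>v\<in>W. if dot v v = \<zero> then 1 else q + 1)"
    proof (rule sum.cong)
      fix v assume v: "v \<in> W"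
      have c: "dot v v \<in> carrier R" using v by (auto simp: W_def)
      have "\<ominus> dot v v \<otimes> inv \<tau> = \<zero> \<longleftrightarrow> dot v v = \<zero>"
        using eq[OF v zero_closed] c \<tau>(1) by (metis r_null r_zero)
      then show "card (B v) = (if dot v v = \<zero> then 1 else q + 1)"
        unfolding B_def using card_sum_two_squares[of "\<ominus> dot v v \<otimes> inv \<tau>"] c i\<tau> by simp
    qed simp
    also have "\<dots> + q * g = (\<Sum>v\<in>W. (if dot v v = \<zero> then 1 else q + 1) + q * of_bool (dot v v = \<zero>))"
    proof -
      have "W \<inter> {v. dot v v = \<zero>} = {v \<in> V n. dot v v = \<zero> \<and> dot v z = \<zero>}" by (auto simp: W_def)
      then show ?thesis using fW by (simp add: sum.distrib g_def flip: sum_distrib_left)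
    qed
    also have "\<dots> = (\<Sum>v\<in>W. q + 1)" by (intro sum.cong) auto
    finally show ?thesis by (simp add: mult.commute)
  qed
  \<comment> \<open>Second count: for fixed \<open>\<mu>\<close> the pairs \<open>(v, l)\<close>
    correspond to the vectors of norm \<open>- \<tau> \<mu>^2\<close> in the full space, by the
    orthogonal decomposition along \<open>z\<close>.\<close>
  have T2: "T = q ^ n"
  proof -
    define \<phi> where "\<phi> = (\<lambda>(v, l). add v (scale l z))"
    have \<phi>V: "\<phi> ` (W \<times> carrier R) \<subseteq> V n" using zn by (auto simp: \<phi>_def W_def)
    have inj: "inj_on \<phi> (W \<times> carrier R)"
    proof (rule inj_onI, clarsimp simp: \<phi>_def)
      fix v l v' l' assume *: "v \<in> W" "l \<in> carrier R" "v' \<in> W" "l' \<in> carrier R"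
        "add v (scale l z) = add v' (scale l' z)"
      have d: "dot (add v (scale l z)) z = l \<otimes> \<tau>" if "v \<in> W" "l \<in> carrier R" for v l
        using that zn \<tau> by (simp add: W_def dot_add_left[where n = n] dot_scale_left[where n = n] flip: \<tau>_def)
      have "l \<otimes> \<tau> = l' \<otimes> \<tau>" using d[OF *(1,2)] d[OF *(3,4)] *(5) by simp
      then have "l = l'" using *(2,4) \<tau> m_rcancel by simp
      then show "v = v' \<and> l = l'" using * zn by (auto simp: W_def add_right_cancel[where n = n])
    qed
    \<comment> \<open>An injection between sets of equal size: \<open>|W|\<close> times
      \<open>q\<close> is \<open>q^n\<close>.\<close>
    have surj: "\<phi> ` (W \<times> carrier R) = V n"
      using card_subset_eq[OF finite_V \<phi>V] card_image[OF inj] cW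
      by (simp add: card_V card_cartesian_product mult.commute)
    have dd: "dot (\<phi> (v, l)) (\<phi> (v, l)) = dot v v \<oplus> \<tau> \<otimes> (l \<otimes> l)" if "v \<in> W" "l \<in> carrier R" for v l
      using that zn \<tau> dot_add_scale_self[of v n z l] dot_closed[of v n v]
      by (simp add: \<phi>_def W_def m_comm flip: \<tau>_def)
    have "T = (\<Sum>\<mu>\<in>carrier R. card {p \<in> W \<times> carrier R. case p of (v, l) \<Rightarrow> dot v v \<oplus> \<tau> \<otimes> (l \<otimes> l \<oplus> \<mu> \<otimes> \<mu>) = \<zero>})"
    proof -
      have "T = card (SIGMA p : W \<times> carrier R. {\<mu> \<in> carrier R. case p of (v, l) \<Rightarrow> dot v v \<oplus> \<tau> \<otimes> (l \<otimes> l \<oplus> \<mu> \<otimes> \<mu>) = \<zero>})"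
        unfolding T_def by (rule arg_cong[where f = card]) auto
      also have "\<dots> = (\<Sum>p\<in>W \<times> carrier R. card {\<mu> \<in> carrier R. case p of (v, l) \<Rightarrow> dot v v \<oplus> \<tau> \<otimes> (l \<otimes> l \<oplus> \<mu> \<otimes> \<mu>) = \<zero>})"
        using fW by (intro card_SigmaI) (auto simp: finite_carrier)
      also have "\<dots> = (\<Sum>\<mu>\<in>carrier R. card {p \<in> W \<times> carrier R. case p of (v, l) \<Rightarrow> dot v v \<oplus> \<tau> \<otimes> (l \<otimes> l \<oplus> \<mu> \<otimes> \<mu>) = \<zero>})"
        using fW by (intro sum_card_swap) (auto simp: finite_carrier)
      finally show ?thesis .
    qed
    also have "\<dots> = (\<Sum>\<mu>\<in>carrier R. rep n (\<ominus> (\<tau> \<otimes> (\<mu> \<otimes> \<mu>))))"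
    proof (rule sum.cong)
      fix \<mu> assume \<mu>: "\<mu> \<in> carrier R"
      have e: "dot v v \<oplus> \<tau> \<otimes> (l \<otimes> l \<oplus> \<mu> \<otimes> \<mu>) = \<zero> \<longleftrightarrow> dot (\<phi> (v, l)) (\<phi> (v, l)) = \<ominus> (\<tau> \<otimes> (\<mu> \<otimes> \<mu>))"
        if "v \<in> W" "l \<in> carrier R" for v l
      proof -
        have c: "dot v v \<in> carrier R" using that by (auto simp: W_def)
        have "dot v v \<oplus> \<tau> \<otimes> (l \<otimes> l \<oplus> \<mu> \<otimes> \<mu>) = dot (\<phi> (v, l)) (\<phi> (v, l)) \<oplus> \<tau> \<otimes> (\<mu> \<otimes> \<mu>)"
          using dd[OF that] c that \<tau> \<mu> by (simp add: r_distr a_assoc)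
        moreover have "dot (\<phi> (v, l)) (\<phi> (v, l)) \<in> carrier R" using dd[OF that] c that \<tau> by simp
        ultimately show ?thesis using \<tau>(1) \<mu>
          by (metis m_closed a_inv_closed minus_equality minus_minus l_neg)
      qed
      have "{x \<in> V n. dot x x = \<ominus> (\<tau> \<otimes> (\<mu> \<otimes> \<mu>))} =
        \<phi> ` {p \<in> W \<times> carrier R. case p of (v, l) \<Rightarrow> dot v v \<oplus> \<tau> \<otimes> (l \<otimes> l \<oplus> \<mu> \<otimes> \<mu>) = \<zero>}"
      proof (intro equalityI subsetI)
        fix x assume x: "x \<in> {x \<in> V n. dot x x = \<ominus> (\<tau> \<otimes> (\<mu> \<otimes> \<mu>))}"
        then have "x \<in> \<phi> ` (W \<times> carrier R)" unfolding surj by simp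
        then obtain v l where "v \<in> W" "l \<in> carrier R" "x = \<phi> (v, l)" by auto
        then show "x \<in> \<phi> ` {p \<in> W \<times> carrier R. case p of (v, l) \<Rightarrow> dot v v \<oplus> \<tau> \<otimes> (l \<otimes> l \<oplus> \<mu> \<otimes> \<mu>) = \<zero>}"
          using x e[of v l] by (intro image_eqI[of _ _ "(v, l)"]) auto
      next
        fix x assume "x \<in> \<phi> ` {p \<in> W \<times> carrier R. case p of (v, l) \<Rightarrow> dot v v \<oplus> \<tau> \<otimes> (l \<otimes> l \<oplus> \<mu> \<otimes> \<mu>) = \<zero>}"
        then obtain v l where "v \<in> W" "l \<in> carrier R" "x = \<phi> (v, l)"
           "dot v v \<oplus> \<tau> \<otimes> (l \<otimes> l \<oplus> \<mu> \<otimes> \<mu>) = \<zero>" by auto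
        then show "x \<in> {x \<in> V n. dot x x = \<ominus> (\<tau> \<otimes> (\<mu> \<otimes> \<mu>))}"
          using e[of v l] \<phi>V by auto
      qed
      moreover have "inj_on \<phi> {p \<in> W \<times> carrier R. case p of (v, l) \<Rightarrow> dot v v \<oplus> \<tau> \<otimes> (l \<otimes> l \<oplus> \<mu> \<otimes> \<mu>) = \<zero>}"
        using inj by (rule inj_on_subset) auto
      ultimately show "card {p \<in> W \<times> carrier R. case p of (v, l) \<Rightarrow> dot v v \<oplus> \<tau> \<otimes> (l \<otimes> l \<oplus> \<mu> \<otimes> \<mu>) = \<zero>}
         = rep n (\<ominus> (\<tau> \<otimes> (\<mu> \<otimes> \<mu>)))"
        by (simp add: card_image rep_def)
    qed simp
    finally have "real T = (\<Sum>\<mu>\<in>carrier R. real (rep n (\<ominus> (\<tau> \<otimes> (\<mu> \<otimes> \<mu>)))))" by simp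
    \<comment> \<open>The extra \<open>(-q)^m\<close> at \<open>\<mu> = 0\<close> cancels the
      \<open>q\<close> terms \<open>(-q)^m / q\<close>, so the total is \<open>q^n\<close> whatever
      the parity of \<open>m\<close>.\<close>
    also have "\<dots> = (\<Sum>\<mu>\<in>carrier R. (real q ^ n - (- real q) ^ m) / real q + (- real q) ^ m * of_bool (\<mu> = \<zero>))"
    proof (rule sum.cong)
      fix \<mu> assume \<mu>: "\<mu> \<in> carrier R"
      have "\<ominus> (\<tau> \<otimes> (\<mu> \<otimes> \<mu>)) = \<zero> \<longleftrightarrow> \<mu> = \<zero>"
        using \<mu> \<tau> integral_iff by (metis m_closed minus_minus minus_zero)
      then show "real (rep n (\<ominus> (\<tau> \<otimes> (\<mu> \<otimes> \<mu>)))) =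
          (real q ^ n - (- real q) ^ m) / real q + (- real q) ^ m * of_bool (\<mu> = \<zero>)"
        using rep_eq[of "\<ominus> (\<tau> \<otimes> (\<mu> \<otimes> \<mu>))" m] \<mu> \<tau> by (simp add: n_def)
    qed simp
    also have "\<dots> = real q * ((real q ^ n - (- real q) ^ m) / real q) + (- real q) ^ m * (\<Sum>\<mu>\<in>carrier R. of_bool (\<mu> = \<zero>))"
      by (simp only: sum.distrib sum_constant sum_distrib_left)
    also have "(\<Sum>\<mu>\<in>carrier R. of_bool (\<mu> = \<zero>)) = (1::real)"
    proof -
      have "carrier R \<inter> {\<mu>. \<mu> = \<zero>} = {\<zero>}" by auto
      then show ?thesis by (simp add: finite_carrier)
    qed
    finally have "real T = real (q ^ n)" using q0 by simp
    then show ?thesis by (simp only: of_nat_eq_iff)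
  qed
  have "real (q * card W) = real (q ^ n)" using cW by (simp only:)
  then have W': "real (card W) = real q ^ n / real q" using q0 by (simp add: field_simps)
  have "real (T + q * g) = real ((q + 1) * card W)" using T1 by (simp only:)
  then have "real q ^ n + real q * real g = (real q + 1) * (real q ^ n / real q)"
    using q0 unfolding T2 by (simp add: W' field_simps)
  then show ?thesis using q0 unfolding g_def n_def by (simp add: field_simps power2_eq_square)
qed

text \<open>Summing the Cauchy-Schwarz bound over isotropic \<open>v\<close> gives a lower bound for
  an expression in which the number of isotropic differences has coefficient
  \<open>r - Q * H\<close>. For odd \<open>m\<close> this coefficient is negative, which turns the
  lower bound into an upper bound for that number.\<close>

lemma card_isotropic_differences:
  assumes A: "A \<subseteq> V (2 * m)" and m: "odd m"
  shows "real (card {(a, c) \<in> A \<times> A. dot (sub a c) (sub a c) = \<zero>})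
    \<le> real (card A) ^ 2 / real q + real q ^ m / real q * real (card A)"
proof -
  define n where "n = 2 * m"
  have An: "A \<subseteq> V n" using A by (simp add: n_def)
  have fA: "finite A" using An finite_V finite_subset by blast
  define Z where "Z = {(a, c) \<in> A \<times> A. dot (sub a c) (sub a c) = \<zero>}"
  define N where "N = real (card A)"
  define Q where "Q = real q"
  have Q: "Q \<ge> 2" using q_ge_2 by (simp add: Q_def)
  define r where "r = real (rep n \<zero>)"
  define H where "H = Q ^ n / Q ^ 2"
  \<comment> \<open>Oddness of \<open>m\<close> replaces \<open>(-q)^m\<close> by
    \<open>-q^m\<close>.\<close>
  have r: "r = Q ^ n / Q - (Q - 1) * Q ^ m / Q"
    using rep_eq[of \<zero> m] m Q by (simp add: r_def n_def Q_def field_simps power_minus_odd)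
  define h where "h z = real (card {v \<in> V n. dot v v = \<zero> \<and> dot v z = \<zero>})" for z
  \<comment> \<open>One formula for three cases: zero differences give \<open>r\<close>, other
    isotropic ones \<open>r - (Q - 1) * H\<close>, and non-isotropic ones \<open>H\<close>. The last
    term corrects the diagonal.\<close>
  have h: "h (sub a c) = H + (r - Q * H) * of_bool ((a, c) \<in> Z) + (Q - 1) * H * of_bool (a = c)"
    if "a \<in> A" "c \<in> A" for a c
  proof -
    have V: "a \<in> V n" "c \<in> V n" using that An by auto
    then have sV: "sub a c \<in> V n" by simp
    consider "a = c" | "a \<noteq> c" "(a, c) \<in> Z" | "a \<noteq> c" "(a, c) \<notin> Z" by blast
    then show ?thesis
    proof cases
      case 1
      then have eq: "sub a c = nul n" using V sub_eq_nul by blast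
      then have "(a, c) \<in> Z" using that by (simp add: Z_def dot_nul)
      moreover have "h (sub a c) = r"
        unfolding eq h_def r_def rep_def by (intro arg_cong[where f = "\<lambda>S. real (card S)"]) (auto simp: dot_nul_right)
      ultimately show ?thesis using 1 by (simp add: algebra_simps)
    next
      case 2
      then have "sub a c \<noteq> nul n" using V sub_eq_nul by blast
      then have "h (sub a c) = r - (Q - 1) * H"
        using card_isotropic_tangent[OF sV] 2(2) by (simp add: h_def r_def H_def Q_def Z_def)
      then show ?thesis using 2 by (simp add: algebra_simps)
    next
      case 3
      then have "h (sub a c) = H"
        using card_isotropic_nontangent[of "sub a c" m] sV that by (simp add: h_def H_def Q_def Z_def n_def)
      then show ?thesis using 3 by simp
    qed
  qed
  \<comment> \<open>The form \<open>dot v\<close> splits \<open>A\<close> into \<open>q\<close>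
    fibres, and the pairs with equal value are counted by the squares of the fibre sizes.\<close>
  have CS: "N ^ 2 \<le> Q * real (card {p \<in> A \<times> A. dot v (sub (fst p) (snd p)) = \<zero>})" if v: "v \<in> V n" for v
  proof -
    have "{p \<in> A \<times> A. dot v (sub (fst p) (snd p)) = \<zero>} = {(a, c) \<in> A \<times> A. dot v a = dot v c}"
      using An v by (auto simp: dot_sub_right[where n = n] subset_iff)
    moreover have dA: "dot v ` A \<subseteq> carrier R" using An v by (auto intro!: dot_closed[of _ n])
    ultimately have eq: "card {p \<in> A \<times> A. dot v (sub (fst p) (snd p)) = \<zero>} = (\<Sum>t\<in>carrier R. (card {a \<in> A. dot v a = t})\<^sup>2)"
      using card_eq_fibre_squares[OF fA finite_carrier dA] by (simp only:)
    have "card A = card (\<Union>t\<in>carrier R. {a \<in> A. dot v a = t})"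
      using dA by (intro arg_cong[where f = card]) auto
    also have "\<dots> = (\<Sum>t\<in>carrier R. card {a \<in> A. dot v a = t})"
      using fA by (intro card_UN_disjoint) (auto simp: finite_carrier)
    finally have "N = (\<Sum>t\<in>carrier R. real (card {a \<in> A. dot v a = t}))" by (simp add: N_def)
    then have "N ^ 2 \<le> (\<Sum>t\<in>carrier R. (real (card {a \<in> A. dot v a = t}))\<^sup>2) * Q"
      unfolding Q_def using sum_squared_le_sum_of_squares by metis
    then show ?thesis unfolding eq by (simp add: mult.commute)
  qed
  define S where "S = {v \<in> V n. dot v v = \<zero>}"
  have fS: "finite S" by (simp add: S_def)
  have "r * N ^ 2 = (\<Sum>v\<in>S. N ^ 2)" by (simp add: S_def r_def rep_def)
  also have "\<dots> \<le> (\<Sum>v\<in>S. Q * real (card {p \<in> A \<times> A. dot v (sub (fst p) (snd p)) = \<zero>}))"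
    using CS by (intro sum_mono) (simp add: S_def)
  also have "\<dots> = Q * real (\<Sum>v\<in>S. card {p \<in> A \<times> A. dot v (sub (fst p) (snd p)) = \<zero>})"
    by (simp add: sum_distrib_left)
  also have "(\<Sum>v\<in>S. card {p \<in> A \<times> A. dot v (sub (fst p) (snd p)) = \<zero>}) =
      (\<Sum>p\<in>A \<times> A. card {v \<in> S. dot v (sub (fst p) (snd p)) = \<zero>})"
    using fA fS by (intro sum_card_swap) auto
  also have "real \<dots> = (\<Sum>p\<in>A \<times> A. h (sub (fst p) (snd p)))"
    by (simp add: h_def S_def conj_assoc)
  also have "\<dots> = (\<Sum>p\<in>A \<times> A. H + (r - Q * H) * of_bool (p \<in> Z) + (Q - 1) * H * of_bool (fst p = snd p))"
    using h by (intro sum.cong) auto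
  also have "\<dots> = N ^ 2 * H + (r - Q * H) * (\<Sum>p\<in>A \<times> A. of_bool (p \<in> Z)) + (Q - 1) * H * (\<Sum>p\<in>A \<times> A. of_bool (fst p = snd p))"
    by (simp only: sum.distrib sum_constant sum_distrib_left card_cartesian_product N_def power2_eq_square of_nat_mult)
  also have "(\<Sum>p\<in>A \<times> A. of_bool (p \<in> Z)) = real (card Z)"
  proof -
    have "A \<times> A \<inter> {p. p \<in> Z} = Z" by (auto simp: Z_def)
    then show ?thesis using fA by simp
  qed
  also have "(\<Sum>p\<in>A \<times> A. of_bool (fst p = snd p)) = N"
  proof -
    have "A \<times> A \<inter> {p. fst p = snd p} = (\<lambda>a. (a, a)) ` A" by auto
    then show ?thesis using fA by (simp add: card_image inj_on_def N_def)
  qed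
  finally have "r * N ^ 2 \<le> Q * (N ^ 2 * H + (r - Q * H) * real (card Z) + (Q - 1) * H * N)" .
  moreover have "Q * H = Q ^ n / Q" using Q by (simp add: H_def power2_eq_square)
  then have "Q * (N ^ 2 * H + (r - Q * H) * real (card Z) + (Q - 1) * H * N) =
      N ^ 2 * (Q ^ n / Q) - (Q - 1) * Q ^ m * real (card Z) + (Q - 1) * (Q ^ n / Q) * N"
    using Q unfolding r by (simp add: field_simps H_def power2_eq_square)
  moreover have "r * N ^ 2 = N ^ 2 * (Q ^ n / Q) - (Q - 1) * Q ^ m * (N ^ 2 / Q)"
    using Q unfolding r by (simp add: field_simps)
  \<comment> \<open>The main terms \<open>N^2 * Q^n / Q\<close> on both sides cancel; dividing by
    \<open>(Q - 1) * Q^m\<close> then gives the claim.\<close>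
  ultimately have "(Q - 1) * Q ^ m * real (card Z) \<le> (Q - 1) * Q ^ m * (N ^ 2 / Q) + (Q - 1) * (Q ^ n / Q) * N"
    by linarith
  also have "\<dots> = (Q - 1) * Q ^ m * (N ^ 2 / Q + Q ^ m / Q * N)"
  proof -
    have "Q ^ n = Q ^ m * Q ^ m" by (simp add: n_def mult_2 power_add)
    then show ?thesis using Q by (simp add: field_simps)
  qed
  finally have "real (card Z) \<le> N ^ 2 / Q + Q ^ m / Q * N"
    using Q by (subst (asm) mult_le_cancel_left_pos) auto
  then show ?thesis by (simp add: Z_def N_def Q_def)
qed

end

section \<open>Additive energy and right angles\<close>

context fin_field_3mod4
begin

text \<open>Isotropic pairs \<open>(a, c)\<close> are few, so all of \<open>A\<close> is allowed for
  \<open>b\<close>; the other pairs are handled by \<open>nonisotropic_corners\<close>. Each part is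
  at most the bracket on the right, whence the factor 2.\<close>

lemma right_angles_bound:
  assumes A: "A \<subseteq> V (2 * m)" and m: "odd m"
  shows "real (card {(a, b, c) \<in> A \<times> A \<times> A. dot (sub a c) (sub b c) = \<zero>})
    \<le> 2 * (real (card A) ^ 3 / real q + sqrt (real q ^ (2 * m) / real q) * real (card A) ^ 2)"
proof -
  define n where "n = 2 * m"
  have An: "A \<subseteq> V n" using A by (simp add: n_def)
  have fA: "finite A" using An finite_V finite_subset by blast
  define I where "I = {(a, c) \<in> A \<times> A. dot (sub a c) (sub a c) \<noteq> \<zero>}"
  define Z where "Z = {(a, c) \<in> A \<times> A. dot (sub a c) (sub a c) = \<zero>}"
  define f where "f = (\<lambda>(a, c). card {b \<in> A. dot (sub b c) (sub a c) = \<zero>})"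
  have fin: "finite I" "finite Z"
    by (rule finite_subset[of _ "A \<times> A"]; use fA in \<open>auto simp: I_def Z_def\<close>)+
  have ZI: "Z \<union> I = A \<times> A" "Z \<inter> I = {}" by (auto simp: Z_def I_def)
  have q1: "real q \<ge> 1" using q_ge_2 by simp
  have comm: "dot (sub a c) (sub b c) = dot (sub b c) (sub a c)" if "a \<in> A" "b \<in> A" "c \<in> A" for a b c
    using that An by (intro dot_comm[of _ n] sub_closed) auto
  have "card {(a, b, c) \<in> A \<times> A \<times> A. dot (sub a c) (sub b c) = \<zero>}
      = card (SIGMA p:A \<times> A. {b \<in> A. dot (sub b (snd p)) (sub (fst p) (snd p)) = \<zero>})"
  proof (rule bij_betw_same_card[of "\<lambda>(a, b, c). ((a, c), b)"], rule bij_betw_imageI)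
    show "(\<lambda>(a, b, c). ((a, c), b)) ` {(a, b, c) \<in> A \<times> A \<times> A. dot (sub a c) (sub b c) = \<zero>}
        = (SIGMA p:A \<times> A. {b \<in> A. dot (sub b (snd p)) (sub (fst p) (snd p)) = \<zero>})" (is "?g ` ?S = ?T")
    proof (intro equalityI subsetI)
      fix x assume "x \<in> ?T"
      then obtain a b c where "x = ((a, c), b)" "a \<in> A" "b \<in> A" "c \<in> A" "dot (sub b c) (sub a c) = \<zero>" by auto
      then show "x \<in> ?g ` ?S" using comm by (intro image_eqI[of _ _ "(a, b, c)"]) auto
    qed (use comm in auto)
  qed (auto simp: inj_on_def)
  also have "\<dots> = (\<Sum>p\<in>A \<times> A. f p)"
    using fA by (subst card_SigmaI) (auto simp: f_def case_prod_unfold)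
  also have "\<dots> = (\<Sum>p\<in>Z. f p) + (\<Sum>p\<in>I. f p)"
    unfolding ZI(1)[symmetric] by (rule sum.union_disjoint[OF fin(2,1) ZI(2)])
  also have "(\<Sum>p\<in>Z. f p) \<le> (\<Sum>p\<in>Z. card A)"
    using fA by (intro sum_mono) (auto simp: f_def intro!: card_mono)
  finally have "real (card {(a, b, c) \<in> A \<times> A \<times> A. dot (sub a c) (sub b c) = \<zero>})
      \<le> real (card Z) * real (card A) + (\<Sum>p\<in>I. real (f p))"
    by (simp flip: of_nat_mult of_nat_add of_nat_sum)
  also have "(\<Sum>p\<in>I. real (f p)) \<le> real (card A) ^ 3 / real q + sqrt (real q ^ n / real q) * real (card A) ^ 2"
    using nonisotropic_corners[OF An] by (simp add: I_def f_def case_prod_unfold)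
  also have "real (card Z) * real (card A) \<le>
      (real (card A) ^ 2 / real q + sqrt (real q ^ n / real q) * real (card A)) * real (card A)"
  proof (rule mult_right_mono)
    \<comment> \<open>The error \<open>q^(m - 1)\<close> of the isotropic part is below
      \<open>q^(m - 1/2)\<close>, the error of the other part.\<close>
    have "real q ^ m / real q = sqrt ((real q ^ m / real q)\<^sup>2)" by simp
    also have "\<dots> \<le> sqrt (real q ^ n / real q)"
      using q1 by (intro real_sqrt_le_mono) (simp add: n_def power_divide power_mult mult.commute[of 2] frac_le power2_eq_square)
    finally have "real q ^ m / real q * real (card A) \<le> sqrt (real q ^ n / real q) * real (card A)"
      by (intro mult_right_mono) auto
    then show "real (card Z) \<le> real (card A) ^ 2 / real q + sqrt (real q ^ n / real q) * real (card A)"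
      using card_isotropic_differences[OF A m] by (simp add: Z_def)
  qed simp
  finally show ?thesis by (simp add: n_def field_simps power_numeral_reduce)
qed

text \<open>A quadruple maps to the projections of \<open>a\<close>, \<open>b\<close>,
  \<open>c\<close>, which form a right angle at \<open>c\<close>. The map is injective: the
  projection is injective on a graph, and \<open>a + b = c + e\<close> determines
  \<open>e\<close>.\<close>

lemma add_energy_paraboloid_le:
  assumes A: "A \<subseteq> paraboloid R (Suc n)"
  defines "B \<equiv> butlast ` A"
  shows "B \<subseteq> V n" "card B = card A"
    "add_energy R A \<le> card {(a, b, c) \<in> B \<times> B \<times> B. dot (sub a c) (sub b c) = \<zero>}"
proof -
  have A': "\<exists>y\<in>V n. x = y @ [dot y y]" if "x \<in> A" for x using that A mem_paraboloid by auto
  have inj: "inj_on butlast A"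
  proof (rule inj_onI)
    fix x y assume "x \<in> A" "y \<in> A" "butlast x = butlast y"
    then show "x = y" using A'[of x] A'[of y] by auto
  qed
  show BV: "B \<subseteq> V n" unfolding B_def using A' by fastforce
  show "card B = card A" unfolding B_def using inj by (rule card_image)
  have fB: "finite B" using BV finite_V finite_subset by blast
  have key: "butlast a \<in> B \<and> butlast b \<in> B \<and> butlast c \<in> B \<and>
      dot (sub (butlast a) (butlast c)) (sub (butlast b) (butlast c)) = \<zero> \<and>
      (\<forall>e'\<in>A. add a b = add c e' \<longrightarrow> e = e')"
    if abce: "a \<in> A" "b \<in> A" "c \<in> A" "e \<in> A" "add a b = add c e" for a b c e
  proof -
    obtain a' b' c' e' where V: "a' \<in> V n" "b' \<in> V n" "c' \<in> V n" "e' \<in> V n"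
      and eq: "a = a' @ [dot a' a']" "b = b' @ [dot b' b']" "c = c' @ [dot c' c']" "e = e' @ [dot e' e']"
      using A' abce(1-4) by metis
    have s: "add a' b' = add c' e'" "dot a' a' \<oplus> dot b' b' = dot c' c' \<oplus> dot e' e'"
      using abce(5) V unfolding eq by (simp_all add: add_snoc)
    have "dot (sub a' c') (sub b' c') = \<zero>"
      by (rule double_eq_zero[OF _ dot_sub_sub_add_self[OF V s]])
        (intro dot_closed[of _ n] sub_closed V)
    \<comment> \<open>Cancelling \<open>c'\<close> identifies the projections; the last coordinates
      then agree because both points lie on the graph.\<close>
    moreover have "e = e2" if e2: "e2 \<in> A" "add a b = add c e2" for e2
    proof -
      obtain y where y: "y \<in> V n" "e2 = y @ [dot y y]" using A' e2 by blast
      have "add c' e' = add c' y" using e2(2) abce(5) V y unfolding eq y(2) by (simp add: add_snoc)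
      then show ?thesis using V y add_left_cancel unfolding eq by blast
    qed
    moreover have "butlast a \<in> B" "butlast b \<in> B" "butlast c \<in> B"
      using abce(1-3) unfolding B_def by blast+
    ultimately show ?thesis using eq by auto
  qed
  have fin: "finite {(a, b, c) \<in> B \<times> B \<times> B. dot (sub a c) (sub b c) = \<zero>}"
    by (rule finite_subset[of _ "B \<times> B \<times> B"]) (use fB in auto)
  show "add_energy R A \<le> card {(a, b, c) \<in> B \<times> B \<times> B. dot (sub a c) (sub b c) = \<zero>}"
    unfolding add_energy_def
  proof (rule card_inj_on_le[OF _ _ fin, of "\<lambda>(a, b, c, e). (butlast a, butlast b, butlast c)"])
    show "inj_on (\<lambda>(a, b, c, e). (butlast a, butlast b, butlast c))
        {(a, b, c, e). a \<in> A \<and> b \<in> A \<and> c \<in> A \<and> e \<in> A \<and> add a b = add c e}"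
    proof (rule inj_onI, clarsimp)
      fix a b c e a' b' c' e'
      assume 1: "a \<in> A" "b \<in> A" "c \<in> A" "e \<in> A" "add a b = add c e"
        and 2: "a' \<in> A" "b' \<in> A" "c' \<in> A" "e' \<in> A" "add a' b' = add c' e'"
        and 3: "butlast a = butlast a'" "butlast b = butlast b'" "butlast c = butlast c'"
      have "a = a'" "b = b'" "c = c'" using 1 2 3 inj by (auto dest: inj_onD)
      moreover have "e = e'" using key[OF 1] 2 calculation by auto
      ultimately show "a = a' \<and> b = b' \<and> c = c' \<and> e = e'" by simp
    qed
    show "(\<lambda>(a, b, c, e). (butlast a, butlast b, butlast c)) `
        {(a, b, c, e). a \<in> A \<and> b \<in> A \<and> c \<in> A \<and> e \<in> A \<and> add a b = add c e}
        \<subseteq> {(a, b, c) \<in> B \<times> B \<times> B. dot (sub a c) (sub b c) = \<zero>}"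
      using key by auto
  qed
qed

end

theorem theorem2p1:
  shows "\<exists>C::real. \<forall>(R::'a ring) (k::nat) (d::nat) (A::'a list set).
    field R \<and> finite (carrier R) \<and>
    (\<exists>p m. prime (p::nat) \<and> odd p \<and> m > 0 \<and> card (carrier R) = p ^ m) \<and>
    card (carrier R) mod 4 = 3 \<and>
    k > 0 \<and> d = 4 * k + 3 \<and> A \<subseteq> paraboloid R d \<longrightarrow>
    real (add_energy R A) \<le>
      C * (real (card A) ^ 3 / real (card (carrier R)) +
           real (card (carrier R)) powr ((real d - 2) / 2) * real (card A) ^ 2)"
proof (intro exI[of _ 2] allI impI, elim conjE)
  fix R :: "'a ring" and k d :: nat and A :: "'a list set"
  assume R: "field R" "finite (carrier R)" "card (carrier R) mod 4 = 3"
    and d: "d = 4 * k + 3" and A: "A \<subseteq> paraboloid R d"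
  interpret field R by (rule R)
  interpret fin_field_3mod4 R by unfold_locales (rule R)+
  \<comment> \<open>The projected dimension is \<open>d - 1 = 4k + 2 = 2m\<close>, and
    \<open>m = 2k + 1\<close> is odd, as the elliptic case requires.\<close>
  define m where "m = 2 * k + 1"
  have m: "odd m" "d = Suc (2 * m)" by (auto simp: m_def d)
  note le = add_energy_paraboloid_le[OF A[unfolded m(2)]]
  have "real (add_energy R A) \<le> 2 * (real (card A) ^ 3 / real q + sqrt (real q ^ (2 * m) / real q) * real (card A) ^ 2)"
    using right_angles_bound[OF le(1) m(1)] le(3) unfolding le(2) by linarith
  \<comment> \<open>Here \<open>2m - 1 = d - 2\<close>, so the root is the power in the
    claim.\<close>
  also have "sqrt (real q ^ (2 * m) / real q) = real q powr ((real d - 2) / 2)"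
  proof -
    have "real q > 0" using q_ge_2 by simp
    then have "real q ^ (2 * m) / real q = real q powr (real d - 2)"
      by (simp add: m(2) powr_diff powr_realpow[symmetric] powr_add)
    then show ?thesis by (simp add: powr_half_sqrt[symmetric] powr_powr)
  qed
  finally show "real (add_energy R A) \<le> 2 * (real (card A) ^ 3 / real (card (carrier R)) +
           real (card (carrier R)) powr ((real d - 2) / 2) * real (card A) ^ 2)" .
qed

end
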